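(* For $(\mathcal{A},P)\in\mathcal{P}_u(\alpha_1,\tau_1,S_1,\nu_1)$, an $S_1$-homotopy invariant is given by $$J(P)=(-t)^{-3w(P)}\sum_{s:\ \text{states}}t^{\sigma(s)}(-t^2-t^{-2})^{|s|-1},$$ where $w(P)=\sum_{A\in\mathcal{A}}|A|$ and the sum runs over all states $s$ of $P$.
   Context: **Nanophrases.** An $\alpha$-alphabet is a finite set $\mathcal{A}$ with a projection $\mathcal{A}\to\alpha$, $A\mapsto|A|$. A nanophrase of length $k\ge0$ over $\alpha$ is a pair $(\mathcal{A},P)$ with $\mathcal{A}$ an $\alpha$-alphabet and $P=w_1|\cdots|w_k$ a sequence of $k$ (possibly empty) words in $\mathcal{A}$, called components, such that every letter of $\mathcal{A}$ occurs exactly twice in $w_1\cdots w_k$. An isomorphism of nanophrases is a projection-preserving bijection of alphabets carrying components to corresponding components. **The set $\mathcal{P}_u(\alpha_1,\tau_1,S_1,\nu_1)$.** Let $\alpha_1=\{1,-1\}$, $\tau_1:1\leftrightarrow-1$, $\nu_1=\mathrm{id}$, $S_1=\{(1,1,1),(1,1,-1),(-1,1,1),(-1,-1,-1),(-1,-1,1),(1,-1,-1)\}$. $S_1$-homotopy is the equivalence relation on nanophrases over $\alpha_1$ generated by isomorphisms and the moves (with $x,y,z,t$ words possibly containing the separator $|$, in which the letters $A$, $B$, $C$ displayed in the move do not occur): (H1) $(\mathcal{A},xAAy)\to(\mathcal{A}\setminus\{A\},xy)$; (H2) $(\mathcal{A},xAByBAz)\to(\mathcal{A}\setminus\{A,B\},xyz)$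 if $|B|=\tau_1(|A|)=-|A|$; (H3) $(\mathcal{A},xAByACzBCt)\to(\mathcal{A},xBAyCAzCBt)$ if $(|A|,|B|,|C|)\in S_1$. Since $\nu_1=\mathrm{id}$, a $\nu_1$-shift moves the first letter of a component to its end (projections unchanged), and a $\nu_1$-permutation interchanges two adjacent components (projections unchanged). For a word $w$, let $w^-$ be the word with its letters in the opposite order. A $\nu_1$-inversion replaces a component $w_i$ by $w_i^-$ and replaces $|A|$ by $-|A|$ for each letter $A$ occurring exactly once in $w_i$, keeping everything else. $\mathcal{P}_u(\alpha_1,\tau_1,S_1,\nu_1)$ is the set of nanophrases over $\alpha_1$ modulo $S_1$-homotopy, $\nu_1$-shifts, $\nu_1$-permutations and $\nu_1$-inversions; its elements are called pseudolinks. **States.** For a phrase $Q$ and a word $w$, $Q_w$ denotes the phrase $Q$ with $|A|$ replaced by $-|A|$ for each letter $A$ occurring exactly once in $w$. A state $s$ of $(\mathcal{A},P)$ is a map $\mathrm{mark}:\mathcal{A}\to\{-1,1\}$. To define $|s|$, phrases over $\alpha_1$ with a state are considered up to $\nu_1$-shifts, $\nu_1$-permutations and $\nu_1$-inversions (markers unchanged), and a letter $A$ is deleted by $w_1|\cdots|AxAy|\cdots|w_k\to w_1|\cdots|x|y|\cdots|w_k$ if $\mathrm{mark}(A)=|A|$, and $\to(w_1|\cdots|x^-y|\cdots|w_k)_x$ if $\mathrm{mark}(A)=-|A|$; $w_1|\cdots|Ax|Ay|\cdots|w_k\to w_1|\cdots|xy|\cdots|w_k$ if $\mathrm{mark}(A)=|A|$,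 and $\to(w_1|\cdots|x^-y|\cdots|w_k)_x$ if $\mathrm{mark}(A)=-|A|$. Deleting all letters gives a phrase $\emptyset|\cdots|\emptyset$ of empty words; its length (number of components) is $|s|$, which does not depend on the order of deletion. Finally $\sigma(s)=\#\{A\in\mathcal{A}:\mathrm{mark}(A)=1\}-\#\{A\in\mathcal{A}:\mathrm{mark}(A)=-1\}$. *)

theory Defs
  imports
    "HOL-Library.FuncSet"
    "HOL-Computational_Algebra.Polynomial"
    "HOL-Computational_Algebra.Fraction_Field"
begin

section \<open>Nanophrases over $\{1,-1\}$\<close>

text \<open>The values of \<open>proj\<close> outside \<open>alphabet\<close> are irrelevant. A phrase of length $k$ is a list of
  $k$ words; the phrase of length 0 is \<open>[]\<close>, the phrase consisting of one empty word is \<open>[[]]\<close>.\<close>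

record 'a nanophrase =
  alphabet :: "'a set"
  proj :: "'a \<Rightarrow> int"
  comps :: "'a list list"

definition nanophrase :: "'a nanophrase \<Rightarrow> bool" where
  "nanophrase N \<longleftrightarrow>
     finite (alphabet N) \<and>
     proj N \<in> alphabet N \<rightarrow> {1, -1} \<and>
     set (concat (comps N)) \<subseteq> alphabet N \<and>
     (\<forall>A\<in>alphabet N. count_list (concat (comps N)) A = 2)"

definition isomorphic :: "'a nanophrase \<Rightarrow> 'a nanophrase \<Rightarrow> bool" where
  "isomorphic M N \<longleftrightarrow>
     (\<exists>f. bij_betw f (alphabet M) (alphabet N) \<and>
          (\<forall>A\<in>alphabet M. proj N (f A) = proj M A) \<and>
          comps N = map (map f) (comps M))"

section \<open>$S_1$-homotopy\<close>

definition tau1 :: "int \<Rightarrow> int" where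
  "tau1 a = - a"

definition S1 :: "(int \<times> int \<times> int) set" where
  "S1 = {(1, 1, 1), (1, 1, -1), (-1, 1, 1), (-1, -1, -1), (-1, -1, 1), (1, -1, -1)}"

text \<open>A word possibly containing the separator is a nonempty list of separator-free words.
  Concatenation of such words merges the last piece of the first with the first piece of the
  second. It is used on nonempty lists only.\<close>

definition glue :: "'a list list \<Rightarrow> 'a list list \<Rightarrow> 'a list list" (infixr "\<odot>" 65) where
  "x \<odot> y = butlast x @ [last x @ hd y] @ tl y"

text \<open>Since both sides of a move are nanophrases, the displayed letters are automatically pairwise
  distinct and do not occur in the remaining words.\<close>

inductive s1_move :: "'a nanophrase \<Rightarrow> 'a nanophrase \<Rightarrow> bool" where
  iso: "s1_move M N"
    if "nanophrase M" "nanophrase N" "isomorphic M N"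
| H1: "s1_move M N"
    if "nanophrase M" "nanophrase N"
      "x \<noteq> []" "y \<noteq> []"
      "comps M = x \<odot> [[A, A]] \<odot> y"
      "comps N = x \<odot> y"
      "alphabet N = alphabet M - {A}"
      "\<forall>D\<in>alphabet N. proj N D = proj M D"
| H2: "s1_move M N"
    if "nanophrase M" "nanophrase N"
      "x \<noteq> []" "y \<noteq> []" "z \<noteq> []"
      "proj M B = tau1 (proj M A)"
      "comps M = x \<odot> [[A, B]] \<odot> y \<odot> [[B, A]] \<odot> z"
      "comps N = x \<odot> y \<odot> z"
      "alphabet N = alphabet M - {A, B}"
      "\<forall>D\<in>alphabet N. proj N D = proj M D"
| H3: "s1_move M N"
    if "nanophrase M" "nanophrase N"
      "x \<noteq> []" "y \<noteq> []" "z \<noteq> []" "t \<noteq> []"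
      "(proj M A, proj M B, proj M C) \<in> S1"
      "comps M = x \<odot> [[A, B]] \<odot> y \<odot> [[A, C]] \<odot> z \<odot> [[B, C]] \<odot> t"
      "comps N = x \<odot> [[B, A]] \<odot> y \<odot> [[C, A]] \<odot> z \<odot> [[C, B]] \<odot> t"
      "alphabet N = alphabet M"
      "\<forall>D\<in>alphabet N. proj N D = proj M D"

definition s1_homotopic :: "'a nanophrase \<Rightarrow> 'a nanophrase \<Rightarrow> bool" where
  "s1_homotopic = equivclp s1_move"

section \<open>Pseudolinks\<close>

definition flip_once :: "'a list \<Rightarrow> ('a \<Rightarrow> int) \<Rightarrow> 'a \<Rightarrow> int" where
  "flip_once w p = (\<lambda>A. if count_list w A = 1 then - p A else p A)"

inductive nu_shift :: "'a nanophrase \<Rightarrow> 'a nanophrase \<Rightarrow> bool" where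
  "nu_shift N (N\<lparr>comps := X @ [w @ [A]] @ Y\<rparr>)"
    if "comps N = X @ [A # w] @ Y"

inductive nu_permutation :: "'a nanophrase \<Rightarrow> 'a nanophrase \<Rightarrow> bool" where
  "nu_permutation N (N\<lparr>comps := X @ [v, u] @ Y\<rparr>)"
    if "comps N = X @ [u, v] @ Y"

inductive nu_inversion :: "'a nanophrase \<Rightarrow> 'a nanophrase \<Rightarrow> bool" where
  "nu_inversion N (N\<lparr>proj := flip_once w (proj N), comps := X @ [rev w] @ Y\<rparr>)"
    if "comps N = X @ [w] @ Y"

definition pseudolink_equiv :: "'a nanophrase \<Rightarrow> 'a nanophrase \<Rightarrow> bool" where
  "pseudolink_equiv =
     equivclp (\<lambda>M N. s1_move M N \<or> nu_shift M N \<or> nu_permutation M N \<or> nu_inversion M N)"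

definition pseudolinks :: "'a nanophrase set set" where
  "pseudolinks =
     {N. nanophrase N} // {(M, N). nanophrase M \<and> nanophrase N \<and> pseudolink_equiv M N}"

section \<open>States\<close>

definition states :: "'a nanophrase \<Rightarrow> ('a \<Rightarrow> int) set" where
  "states N = alphabet N \<rightarrow>\<^sub>E {1, -1}"

inductive delete_letter :: "('a \<Rightarrow> int) \<Rightarrow> 'a nanophrase \<Rightarrow> 'a nanophrase \<Rightarrow> bool"
  for mark :: "'a \<Rightarrow> int" where
  self_eq: "delete_letter mark N
      (N\<lparr>alphabet := alphabet N - {A}, comps := X @ [x, y] @ Y\<rparr>)"
    if "comps N = X @ [A # x @ [A] @ y] @ Y" "mark A = proj N A"
| self_neq: "delete_letter mark N
      (N\<lparr>alphabet := alphabet N - {A}, proj := flip_once x (proj N),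
         comps := X @ [rev x @ y] @ Y\<rparr>)"
    if "comps N = X @ [A # x @ [A] @ y] @ Y" "mark A = - proj N A"
| cross_eq: "delete_letter mark N
      (N\<lparr>alphabet := alphabet N - {A}, comps := X @ [x @ y] @ Y\<rparr>)"
    if "comps N = X @ [A # x, A # y] @ Y" "mark A = proj N A"
| cross_neq: "delete_letter mark N
      (N\<lparr>alphabet := alphabet N - {A}, proj := flip_once x (proj N),
         comps := X @ [rev x @ y] @ Y\<rparr>)"
    if "comps N = X @ [A # x, A # y] @ Y" "mark A = - proj N A"

definition smoothing_step :: "('a \<Rightarrow> int) \<Rightarrow> 'a nanophrase \<Rightarrow> 'a nanophrase \<Rightarrow> bool" where
  "smoothing_step mark M N \<longleftrightarrow>
     nu_shift M N \<or> nu_permutation M N \<or> nu_inversion M N \<or> delete_letter mark M N"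

definition smooths_to :: "('a \<Rightarrow> int) \<Rightarrow> 'a nanophrase \<Rightarrow> nat \<Rightarrow> bool" where
  "smooths_to mark N n \<longleftrightarrow>
     (\<exists>E. (smoothing_step mark)\<^sup>*\<^sup>* N E \<and> comps E = replicate n [])"

definition circles :: "'a nanophrase \<Rightarrow> ('a \<Rightarrow> int) \<Rightarrow> nat" where
  "circles N mark = (THE n. smooths_to mark N n)"

definition sigma :: "'a nanophrase \<Rightarrow> ('a \<Rightarrow> int) \<Rightarrow> int" where
  "sigma N s = int (card {A \<in> alphabet N. s A = 1}) - int (card {A \<in> alphabet N. s A = -1})"

section \<open>The state sum\<close>

text \<open>\<open>t_var\<close> is the indeterminate of the field of rational functions, which contains
  the ring of Laurent polynomials. The field is needed only for the phrase of length 0, whose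
  single state has no circles, so that the exponent $|s|-1$ is $-1$.\<close>

definition t_var :: "int poly fract" where
  "t_var = Fract [:0, 1:] 1"

definition writhe :: "'a nanophrase \<Rightarrow> int" where
  "writhe N = (\<Sum>A\<in>alphabet N. proj N A)"

definition jones :: "'a nanophrase \<Rightarrow> int poly fract" where
  "jones N = (- t_var) powi (- 3 * writhe N) *
     (\<Sum>s\<in>states N. t_var powi sigma N s *
        (- (t_var powi 2) - t_var powi (- 2)) powi (int (circles N s) - 1))"

end

theory Submission
  imports Defs "HOL-Library.Multiset"
begin

text \<open>
  The number of circles of a state is read off from colourings. Every occurrence of a letter has
  an incoming and an outgoing arc, and a state joins the four arcs at a letter in pairs: the
  incoming arc of each occurrence with the outgoing arc of the other one if the marker is the
  projection of the letter, incoming with incoming and outgoing with outgoing otherwise. Call a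
  colouring of the arcs with two colours compatible with the state if joined arcs have the same
  colour. The circles can be coloured independently, so there are $2^{|s|}$ compatible colourings.
  This number makes sense without deleting anything, and it is unchanged by shifts, permutations,
  inversions and deletions of letters (\<open>colourings_smoothing_steps\<close>). Since $n$ empty words have
  $2^n$ colourings and every phrase can be smoothed to empty words (\<open>smooths_to_exists\<close>), $|s|$ is
  well defined and \<open>colourings_circles\<close> recovers it.

  A homotopy move changes a phrase at three spots at most. For given colours of the arcs that
  enter and leave the spots, the colourings inside the spots and those of the rest of the phrase
  are independent. Hence replacing the displayed words by others with $n$ times as many inner
  colourings, for all colours at the ends, multiplies the number of all colourings by $n$
  (\<open>colourings_tangle_replace\<close>). What sits at the spots has finitely many colourings, so the
  comparison is a finite check, and it does not matter how the strands are distributed over the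
  components.

  The rest is the argument of Kauffman, with $d = -t^2-t^{-2}$. For (H1), the two smoothings of the
  letter give $t^{p}d + t^{-p} = (-t)^{3p}$, where $p$ is its projection, and the writhe cancels this
  factor. For (H2), one of the four states of the two letters gives the phrase after the move; the
  other three agree up to one extra circle and cancel because of $t^2 + d + t^{-2} = 0$. For (H3),
  three of the eight states of the letters have the same circles before and after the move
  (\<open>triangle_slides\<close>). Four of the others agree with a single state on the other side of the move,
  up to one extra circle (\<open>triangle_collapses\<close>); by \<open>triangle_factor\<close>, which holds for signs
  in \<open>S1\<close>, their sum is the term of that state. It is the eighth state of its own side, so the two
  sums consist of the same contributions.
\<close>

section \<open>Coloured occurrences of letters\<close>

text \<open>An occurrence of a letter is coloured by the pair of the colours of its incoming and its outgoing
  arc. The argument \<open>e\<close> says whether the marker is the projection of the letter; then the incoming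
  arc of one occurrence is joined to the outgoing arc of the other. So \<open>smoothed e p\<close> is the pair
  that the other occurrence must have if one occurrence has \<open>p\<close>.\<close>

definition smoothed :: "bool \<Rightarrow> bool \<times> bool \<Rightarrow> bool \<times> bool" where
  "smoothed e p = (if e then prod.swap p else p)"

text \<open>Since \<open>smoothed e\<close> is an involution, the condition on two occurrences does not depend on which of
  them comes first, and a multiset of pairs carries enough information. The empty multiset stands
  for a letter that does not occur.\<close>

definition letter_ok :: "bool \<Rightarrow> (bool \<times> bool) multiset \<Rightarrow> bool" where
  "letter_ok e K \<longleftrightarrow> K = {#} \<or> (\<exists>p. K = {#p, smoothed e p#})"

definition occ :: "'a \<Rightarrow> ('a \<times> bool \<times> bool) multiset \<Rightarrow> (bool \<times> bool) multiset" where
  "occ A M = image_mset snd (filter_mset (\<lambda>x. fst x = A) M)"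

text \<open>A triple \<open>(A, i, o)\<close> is an occurrence of \<open>A\<close> with incoming colour \<open>i\<close> and outgoing colour \<open>o\<close>.\<close>

definition compatible :: "('a \<Rightarrow> bool) \<Rightarrow> ('a \<times> bool \<times> bool) multiset \<Rightarrow> bool" where
  "compatible e M \<longleftrightarrow> (\<forall>A. letter_ok (e A) (occ A M))"

lemma smoothed_simps [simp]:
  "smoothed True p = prod.swap p" "smoothed False p = p"
  by (simp_all add: smoothed_def)

lemma smoothed_smoothed [simp]: "smoothed e (smoothed e p) = p"
  by (simp add: smoothed_def)

lemma smoothed_swap [simp]: "smoothed e (prod.swap p) = prod.swap (smoothed e p)"
  by (simp add: smoothed_def)

lemma smoothed_neg: "smoothed (\<not> e) p = prod.swap (smoothed e p)"
  by (simp add: smoothed_def)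

lemma letter_ok_empty [simp]: "letter_ok e {#}"
  by (simp add: letter_ok_def)

lemma letter_ok_pair [simp]: "letter_ok e {#p, q#} \<longleftrightarrow> q = smoothed e p"
proof
  show "q = smoothed e p" if "letter_ok e {#p, q#}"
    using that by (auto simp: letter_ok_def add_eq_conv_ex)
  show "letter_ok e {#p, q#}" if "q = smoothed e p"
    unfolding letter_ok_def using that by blast
qed

lemma letter_ok_size: "letter_ok e K \<Longrightarrow> size K = 0 \<or> size K = 2"
  by (auto simp: letter_ok_def)

lemma occ_simps [simp]:
  "occ A {#} = {#}"
  "occ A (add_mset (B, p) M) = (if B = A then add_mset p (occ A M) else occ A M)"
  "occ A (M + N) = occ A M + occ A N"
  by (simp_all add: occ_def)

lemma size_occ: "size (occ A M) = count (image_mset fst M) A"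
  by (induction M) (auto simp: occ_def)

lemma occ_eq_empty: "A \<notin># image_mset fst M \<Longrightarrow> occ A M = {#}"
  by (metis size_occ count_eq_zero_iff size_eq_0_iff_empty)

lemma compatible_empty [simp]: "compatible e {#}"
  by (simp add: compatible_def)

lemma compatible_cong:
  assumes "\<And>A. A \<in># image_mset fst M \<Longrightarrow> e A = e' A"
  shows "compatible e M = compatible e' M"
proof -
  have "letter_ok (e A) (occ A M) = letter_ok (e' A) (occ A M)" for A
    using assms occ_eq_empty[of A M] by (cases "A \<in># image_mset fst M") auto
  then show ?thesis by (simp add: compatible_def)
qed

lemma compatible_union:
  assumes "\<And>A. A \<in># image_mset fst M \<Longrightarrow> A \<notin># image_mset fst N"
  shows "compatible e (M + N) \<longleftrightarrow> compatible e M \<and> compatible e N"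
proof -
  have "letter_ok (e A) (occ A M + occ A N) \<longleftrightarrow> letter_ok (e A) (occ A M) \<and> letter_ok (e A) (occ A N)" for A
    by (cases "A \<in># image_mset fst M")
      (use assms occ_eq_empty[of A M] occ_eq_empty[of A N] in auto)
  then show ?thesis by (auto simp: compatible_def)
qed

lemma compatible_pair:
  assumes "A \<notin># image_mset fst M"
  shows "compatible e (add_mset (A, p) (add_mset (A, q) M)) \<longleftrightarrow> q = smoothed (e A) p \<and> compatible e M"
proof -
  have "compatible e (add_mset (A, p) (add_mset (A, q) {#}) + M) \<longleftrightarrow>
      compatible e (add_mset (A, p) (add_mset (A, q) {#})) \<and> compatible e M"
    by (rule compatible_union) (use assms in auto)
  moreover have "compatible e (add_mset (A, p) (add_mset (A, q) {#})) \<longleftrightarrow> q = smoothed (e A) p"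
    by (auto simp: compatible_def)
  ultimately show ?thesis by simp
qed

definition reversed :: "'a \<times> bool \<times> bool \<Rightarrow> 'a \<times> bool \<times> bool" where
  "reversed = map_prod id prod.swap"

lemma occ_reversed: "occ A (image_mset reversed M) = image_mset prod.swap (occ A M)"
  by (induction M) (auto simp: reversed_def)

lemma letter_ok_swap: "letter_ok e (image_mset prod.swap K) = letter_ok e K"
proof -
  have "letter_ok e (image_mset prod.swap K)" if "letter_ok e K" for K
    using that unfolding letter_ok_def
    by (metis image_mset_empty image_mset_add_mset smoothed_swap)
  from this[of K] this[of "image_mset prod.swap K"] show ?thesis
    by (auto simp: multiset.map_comp)
qed

lemma letter_ok_flip: "letter_ok (\<not> e) (add_mset (prod.swap p) K) = letter_ok e (add_mset p K)"
proof (cases "\<exists>q. K = {#q#}")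
  case True
  then show ?thesis by (auto simp: smoothed_neg)
next
  case False
  then have "size K \<noteq> 1" by (metis size_1_singleton_mset)
  then show ?thesis
    using letter_ok_size[of e "add_mset p K"] letter_ok_size[of "\<not> e" "add_mset (prod.swap p) K"]
    by auto
qed

text \<open>A word read backwards has the colours at each of its occurrences exchanged. For a letter with one
  occurrence in the word this turns one kind of smoothing into the other, for a letter with two it
  changes nothing. This is the reason why inversions change the sign of precisely those letters
  that occur once in the inverted word.\<close>

lemma compatible_flip:
  assumes "\<And>A. e' A = (if count (image_mset fst M) A = 1 then \<not> e A else e A)"
    and "\<And>A. count (image_mset fst M) A \<noteq> 0 \<Longrightarrow> count (image_mset fst M) A \<noteq> 1 \<Longrightarrow> A \<notin># image_mset fst N"
  shows "compatible e' (image_mset reversed M + N) = compatible e (M + N)"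
proof -
  have "letter_ok (e' A) (occ A (image_mset reversed M + N)) = letter_ok (e A) (occ A (M + N))" for A
  proof -
    consider "size (occ A M) = 0" | "size (occ A M) = 1" | "size (occ A M) \<noteq> 0" "size (occ A M) \<noteq> 1"
      by metis
    then show ?thesis
    proof cases
      case 1
      then show ?thesis using assms(1)[of A] by (simp add: occ_reversed flip: size_occ)
    next
      case 2
      then obtain p where "occ A M = {#p#}" using size_1_singleton_mset by blast
      then show ?thesis using assms(1)[of A] by (simp add: occ_reversed letter_ok_flip flip: size_occ)
    next
      case 3
      then have "occ A N = {#}" using assms(2)[of A] by (simp add: occ_eq_empty size_occ)
      then show ?thesis using assms(1)[of A] 3 by (simp add: occ_reversed letter_ok_swap flip: size_occ)
    qed
  qed
  then show ?thesis by (simp add: compatible_def)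
qed

section \<open>Sums over the colourings of the arcs\<close>

text \<open>The sum of \<open>k\<close> over all colourings of the arcs along \<open>w\<close> whose first arc has colour \<open>a\<close> and whose
  last arc has colour \<open>b\<close>. Passing the coloured occurrences to a continuation \<open>k\<close> turns
  concatenation of words into nesting of sums; collecting them in a multiset makes the order in
  which words are read irrelevant.\<close>

primrec path_sum ::
    "'a list \<Rightarrow> bool \<Rightarrow> bool \<Rightarrow> (('a \<times> bool \<times> bool) multiset \<Rightarrow> nat) \<Rightarrow> nat" where
  "path_sum [] a b k = (if a = b then k {#} else 0)"
| "path_sum (A # w) a b k = (\<Sum>c\<in>UNIV. path_sum w c b (\<lambda>M. k (add_mset (A, a, c) M)))"

text \<open>The colour \<open>b\<close> belongs to the arc that closes up a component. An empty component has this arc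
  only and contributes the factor 2 of a circle.\<close>

primrec phrase_sum :: "'a list list \<Rightarrow> (('a \<times> bool \<times> bool) multiset \<Rightarrow> nat) \<Rightarrow> nat" where
  "phrase_sum [] k = k {#}"
| "phrase_sum (w # ws) k =
     (\<Sum>b\<in>UNIV. path_sum w b b (\<lambda>M. phrase_sum ws (\<lambda>M'. k (M + M'))))"

lemma path_sum_cong:
  assumes "\<And>M. image_mset fst M = mset w \<Longrightarrow> k M = k' M"
  shows "path_sum w a b k = path_sum w a b k'"
  using assms
proof (induction w arbitrary: a k k')
  case (Cons A w)
  show ?case
    by (simp, rule sum.cong[OF refl], rule Cons.IH) (simp add: Cons.prems)
qed simp

lemma path_sum_sum:
  "path_sum w a b (\<lambda>M. \<Sum>i\<in>I. k i M) = (\<Sum>i\<in>I. path_sum w a b (k i))"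
  by (induction w arbitrary: a k) (auto intro: sum.swap)

lemma path_sum_mult: "path_sum w a b (\<lambda>M. n * k M) = n * path_sum w a b k"
  by (induction w arbitrary: a k) (auto simp: sum_distrib_left)

lemma path_sum_zero [simp]: "path_sum w a b (\<lambda>M. 0) = 0"
  by (induction w arbitrary: a) auto

lemma path_sum_if: "path_sum w a b (\<lambda>M. if Q then k M else 0) = (if Q then path_sum w a b k else 0)"
  by simp

lemma path_sum_append:
  "path_sum (u @ v) a b k =
     (\<Sum>c\<in>UNIV. path_sum u a c (\<lambda>M. path_sum v c b (\<lambda>M'. k (M + M'))))"
proof (induction u arbitrary: a k)
  case (Cons A u)
  then show ?case by (simp, subst sum.swap) simp
qed (simp add: UNIV_bool)

lemma path_sum_commute:
  "path_sum u a b (\<lambda>M. path_sum v c d (\<lambda>M'. k M M')) =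
   path_sum v c d (\<lambda>M'. path_sum u a b (\<lambda>M. k M M'))"
  by (induction u arbitrary: a k) (simp_all add: path_sum_sum)

lemma path_sum_rev:
  "path_sum (rev w) b a k = path_sum w a b (\<lambda>M. k (image_mset reversed M))"
proof (induction w arbitrary: a k)
  case (Cons A w)
  show ?case
    by (simp add: path_sum_append Cons reversed_def UNIV_bool)
qed auto

lemma phrase_sum_cong:
  assumes "\<And>M. image_mset fst M = mset (concat ws) \<Longrightarrow> k M = k' M"
  shows "phrase_sum ws k = phrase_sum ws k'"
  using assms
proof (induction ws arbitrary: k k')
  case (Cons w ws)
  show ?case
    by (simp, intro sum.cong path_sum_cong Cons.IH) (auto simp: Cons.prems)
qed simp

lemma phrase_sum_sum:
  "phrase_sum ws (\<lambda>M. \<Sum>i\<in>I. k i M) = (\<Sum>i\<in>I. phrase_sum ws (k i))"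
  by (induction ws arbitrary: k) (auto simp: path_sum_sum intro: sum.swap)

lemma phrase_sum_append:
  "phrase_sum (u @ v) k = phrase_sum u (\<lambda>M. phrase_sum v (\<lambda>M'. k (M + M')))"
  by (induction u arbitrary: k) (simp_all add: add.assoc)

lemma path_phrase_commute:
  "phrase_sum u (\<lambda>M. path_sum v c d (\<lambda>M'. k M M')) =
   path_sum v c d (\<lambda>M'. phrase_sum u (\<lambda>M. k M M'))"
proof (induction u arbitrary: k)
  case (Cons w u)
  show ?case by (simp add: Cons path_sum_sum path_sum_commute[of v])
qed simp

lemma phrase_sum_commute:
  "phrase_sum u (\<lambda>M. phrase_sum v (\<lambda>M'. k M M')) =
   phrase_sum v (\<lambda>M'. phrase_sum u (\<lambda>M. k M M'))"
proof (induction v arbitrary: k)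
  case (Cons w v)
  show ?case by (simp add: phrase_sum_sum path_phrase_commute Cons)
qed simp

text \<open>The components \<open>V\<close> on which a smoothing step acts can be summed last, with the colours of the
  other components fixed.\<close>

lemma phrase_sum_inside:
  "phrase_sum (X @ V @ Y) k = phrase_sum (X @ Y) (\<lambda>R. phrase_sum V (\<lambda>M. k (R + M)))"
  unfolding phrase_sum_append
  by (subst phrase_sum_commute[of Y]) (simp add: ac_simps)

section \<open>Smoothing steps preserve the number of colourings\<close>

text \<open>In terms of multisets of letters, invariance of being a nanophrase under shifts, permutations and
  inversions becomes visible.\<close>

lemma nanophrase_iff_count:
  "nanophrase N \<longleftrightarrow> finite (alphabet N) \<and> proj N \<in> alphabet N \<rightarrow> {1, -1} \<and>
     (\<forall>A. count (mset (concat (comps N))) A = (if A \<in> alphabet N then 2 else 0))"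
  unfolding nanophrase_def count_mset
  by (auto simp: count_list_0_iff subset_iff split: if_splits)

definition colourings :: "('a \<Rightarrow> int) \<Rightarrow> 'a nanophrase \<Rightarrow> nat" where
  "colourings mark N =
     phrase_sum (comps N) (\<lambda>M. of_bool (compatible (\<lambda>A. mark A = proj N A) M))"

lemma colourings_replace:
  assumes "comps N = X @ V @ Y" "comps N' = X @ V' @ Y"
    and "\<And>R. image_mset fst R = mset (concat (X @ Y)) \<Longrightarrow>
      phrase_sum V (\<lambda>M. of_bool (compatible (\<lambda>A. mark A = proj N A) (R + M))) =
      phrase_sum V' (\<lambda>M. of_bool (compatible (\<lambda>A. mark A = proj N' A) (R + M)))"
  shows "colourings mark N = colourings mark N'"
  unfolding colourings_def assms(1,2) phrase_sum_inside[of X _ Y]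
  by (rule phrase_sum_cong) (rule assms(3))

lemma phrase_sum_shift: "phrase_sum [A # w] k = phrase_sum [w @ [A]] k"
  by (simp add: path_sum_append UNIV_bool)

lemma phrase_sum_swap: "phrase_sum [u, v] k = phrase_sum [v, u] k"
  using phrase_sum_commute[of "[u]" "[v]" "\<lambda>M M'. k (M + M')"]
  by (simp add: add.commute)

lemma phrase_sum_inversion:
  "phrase_sum [rev w] k = phrase_sum [w] (\<lambda>M. k (image_mset reversed M))"
  by (simp add: path_sum_rev)

text \<open>The colours of the second occurrence are those of the first one, exchanged. Hence \<open>x\<close> runs from \<open>c\<close>
  back to \<open>c\<close> and \<open>y\<close> from \<open>b\<close> back to \<open>b\<close>: two closed components.\<close>

lemma smooth_self_eq:
  assumes "\<And>b c d d' M M'. \<lbrakk>image_mset fst M = mset x; image_mset fst M' = mset y\<rbrakk> \<Longrightarrow>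
    k (add_mset (A, b, c) (add_mset (A, d, d') (M + M'))) =
      (if (d, d') = (c, b) then k' (M + M') else 0)"
  shows "phrase_sum [A # x @ [A] @ y] k = phrase_sum [x, y] k'"
proof -
  have "phrase_sum [A # x @ [A] @ y] k =
      (\<Sum>b\<in>UNIV. \<Sum>c\<in>UNIV. \<Sum>d\<in>UNIV. path_sum x c d (\<lambda>M. \<Sum>d'\<in>UNIV. path_sum y d' b
         (\<lambda>M'. if (d, d') = (c, b) then k' (M + M') else 0)))"
    unfolding phrase_sum.simps path_sum.simps path_sum_append append.simps
    by (intro sum.cong refl path_sum_cong) (simp add: assms)
  also have "\<dots> = (\<Sum>b\<in>UNIV. \<Sum>c\<in>UNIV. path_sum x c c (\<lambda>M. path_sum y b b (\<lambda>M'. k' (M + M'))))"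
  proof (intro sum.cong refl)
    fix b c
    show "(\<Sum>d\<in>UNIV. path_sum x c d (\<lambda>M. \<Sum>d'\<in>UNIV. path_sum y d' b
         (\<lambda>M'. if (d, d') = (c, b) then k' (M + M') else 0))) =
      path_sum x c c (\<lambda>M. path_sum y b b (\<lambda>M'. k' (M + M')))"
      by (cases b; cases c) (simp_all add: UNIV_bool)
  qed
  also have "\<dots> = phrase_sum [x, y] k'"
    by (subst sum.swap) (simp add: path_sum_sum)
  finally show ?thesis .
qed

text \<open>Here both occurrences have colours \<open>(b, c)\<close>, so \<open>x\<close> runs from \<open>c\<close> to \<open>b\<close>, and so does \<open>y\<close>. They close up
  once \<open>x\<close> is read backwards.\<close>

lemma smooth_self_neq:
  assumes "\<And>b c d d' M M'. \<lbrakk>image_mset fst M = mset x; image_mset fst M' = mset y\<rbrakk> \<Longrightarrow>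
    k (add_mset (A, b, c) (add_mset (A, d, d') (M + M'))) =
      (if (d, d') = (b, c) then k' (image_mset reversed M + M') else 0)"
  shows "phrase_sum [A # x @ [A] @ y] k = phrase_sum [rev x @ y] k'"
proof -
  have "phrase_sum [A # x @ [A] @ y] k =
      (\<Sum>b\<in>UNIV. \<Sum>c\<in>UNIV. \<Sum>d\<in>UNIV. path_sum x c d (\<lambda>M. \<Sum>d'\<in>UNIV. path_sum y d' b
         (\<lambda>M'. if (d, d') = (b, c) then k' (image_mset reversed M + M') else 0)))"
    unfolding phrase_sum.simps path_sum.simps path_sum_append append.simps
    by (intro sum.cong refl path_sum_cong) (simp add: assms)
  also have "\<dots> = phrase_sum [rev x @ y] k'"
    by (simp add: UNIV_bool path_sum_rev path_sum_append)
  finally show ?thesis .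
qed

text \<open>The word \<open>x\<close> runs from \<open>c\<close> to \<open>b\<close> and \<open>y\<close> from \<open>b\<close> to \<open>c\<close>, so that they form one closed component.\<close>

lemma smooth_cross_eq:
  assumes "\<And>b c d d' M M'. \<lbrakk>image_mset fst M = mset x; image_mset fst M' = mset y\<rbrakk> \<Longrightarrow>
    k (add_mset (A, b, c) (add_mset (A, d, d') (M + M'))) =
      (if (d, d') = (c, b) then k' (M + M') else 0)"
  shows "phrase_sum [A # x, A # y] k = phrase_sum [x @ y] k'"
proof -
  have "phrase_sum [A # x, A # y] k =
      (\<Sum>b\<in>UNIV. \<Sum>c\<in>UNIV. path_sum x c b (\<lambda>M. \<Sum>d\<in>UNIV. \<Sum>d'\<in>UNIV. path_sum y d' d
         (\<lambda>M'. if (d, d') = (c, b) then k' (M + M') else 0)))"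
    unfolding phrase_sum.simps path_sum.simps
    by (intro sum.cong refl path_sum_cong) (simp add: assms)
  also have "\<dots> = phrase_sum [x @ y] k'"
    by (simp add: UNIV_bool path_sum_append)
  finally show ?thesis .
qed

text \<open>Both words run from \<open>c\<close> to \<open>b\<close>; again one of them has to be read backwards.\<close>

lemma smooth_cross_neq:
  assumes "\<And>b c d d' M M'. \<lbrakk>image_mset fst M = mset x; image_mset fst M' = mset y\<rbrakk> \<Longrightarrow>
    k (add_mset (A, b, c) (add_mset (A, d, d') (M + M'))) =
      (if (d, d') = (b, c) then k' (image_mset reversed M + M') else 0)"
  shows "phrase_sum [A # x, A # y] k = phrase_sum [rev x @ y] k'"
proof -
  have "phrase_sum [A # x, A # y] k =
      (\<Sum>b\<in>UNIV. \<Sum>c\<in>UNIV. path_sum x c b (\<lambda>M. \<Sum>d\<in>UNIV. \<Sum>d'\<in>UNIV. path_sum y d' d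
         (\<lambda>M'. if (d, d') = (b, c) then k' (image_mset reversed M + M') else 0)))"
    unfolding phrase_sum.simps path_sum.simps
    by (intro sum.cong refl path_sum_cong) (simp add: assms)
  also have "\<dots> = phrase_sum [rev x @ y] k'"
    by (simp add: UNIV_bool path_sum_append path_sum_rev)
  finally show ?thesis .
qed

lemma nanophrase_signs: "nanophrase N \<Longrightarrow> proj N \<in> alphabet N \<rightarrow> {1, -1}"
  by (simp add: nanophrase_def)

lemma nanophrase_count:
  "nanophrase N \<Longrightarrow> count (mset (concat (comps N))) A = (if A \<in> alphabet N then 2 else 0)"
  by (simp add: nanophrase_iff_count)

lemma nanophrase_letter_twice:
  assumes "nanophrase N" "mset (concat (comps N)) = add_mset A (add_mset A R)"
  shows "A \<in> alphabet N" "A \<notin># R"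
proof -
  have *: "Suc (Suc (count R A)) = (if A \<in> alphabet N then 2 else 0)"
    using nanophrase_count[OF assms(1), of A] unfolding assms(2) by simp
  then show "A \<in> alphabet N" by (auto split: if_splits)
  with * have "count R A = 0" by simp
  then show "A \<notin># R" by (simp only: not_in_iff)
qed

lemma nanophrase_rotate:
  assumes "nanophrase N" "alphabet N' = alphabet N" "proj N' \<in> alphabet N \<rightarrow> {1, -1}"
    "mset (concat (comps N')) = mset (concat (comps N))"
  shows "nanophrase N'"
  using assms unfolding nanophrase_iff_count by simp

lemma nanophrase_remove:
  assumes "nanophrase N" "alphabet N' = alphabet N - {A}" "proj N' \<in> alphabet N \<rightarrow> {1, -1}"
    "mset (concat (comps N)) = add_mset A (add_mset A (mset (concat (comps N'))))"
  shows "nanophrase N'"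
  unfolding nanophrase_iff_count
proof (intro conjI allI)
  note A = nanophrase_letter_twice[OF assms(1,4)]
  show "finite (alphabet N')" using assms(1,2) by (simp add: nanophrase_def)
  show "proj N' \<in> alphabet N' \<rightarrow> {1, -1}" using assms(2,3) by auto
  show "count (mset (concat (comps N'))) B = (if B \<in> alphabet N' then 2 else 0)" for B
  proof (cases "B = A")
    case True
    then show ?thesis using A(2) assms(2) unfolding not_in_iff by simp
  next
    case False
    then show ?thesis using nanophrase_count[OF assms(1), of B] assms(2) unfolding assms(4) by simp
  qed
qed

lemma flip_once_signs: "p \<in> S \<rightarrow> {1, -1} \<Longrightarrow> flip_once w p \<in> S \<rightarrow> {1, -1}"
  by (auto simp: flip_once_def Pi_iff)

text \<open>In a nanophrase a letter that occurs twice in \<open>w\<close> does not occur elsewhere, which is what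
  \<open>compatible_flip\<close> requires.\<close>

lemma compatible_flip_once:
  assumes N: "nanophrase N" and mark: "mark \<in> alphabet N \<rightarrow> {1, -1}"
    and M: "image_mset fst M = mset w"
    and MR: "image_mset fst M + image_mset fst R \<subseteq># mset (concat (comps N))"
  shows "compatible (\<lambda>A. mark A = flip_once w (proj N) A) (image_mset reversed M + R) =
    compatible (\<lambda>A. mark A = proj N A) (M + R)"
proof (rule compatible_flip)
  fix A
  have "count (image_mset fst M) A + count (image_mset fst R) A \<le> count (mset (concat (comps N))) A"
    using mset_subset_eq_count[OF MR, of A] by simp
  then have le: "count (image_mset fst M) A + count (image_mset fst R) A \<le> (if A \<in> alphabet N then 2 else 0)"
    using nanophrase_count[OF N] by simp
  have cw: "count_list w A = count (image_mset fst M) A"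
    by (simp only: M count_mset)
  show "(mark A = flip_once w (proj N) A) =
      (if count (image_mset fst M) A = 1 then mark A \<noteq> proj N A else mark A = proj N A)"
  proof (cases "count (image_mset fst M) A = 1")
    case True
    then have "A \<in> alphabet N" using le by (cases "A \<in> alphabet N") auto
    then have "mark A \<in> {1, -1}" "proj N A \<in> {1, -1}"
      using mark nanophrase_signs[OF N] by auto
    then have "(mark A = - proj N A) = (mark A \<noteq> proj N A)" by auto
    then show ?thesis using True by (simp add: flip_once_def cw)
  next
    case False
    then show ?thesis by (simp add: flip_once_def cw)
  qed
  show "A \<notin># image_mset fst R"
    if "count (image_mset fst M) A \<noteq> 0" "count (image_mset fst M) A \<noteq> 1"
  proof -
    have "m + n \<le> (if Q then 2 else 0) \<Longrightarrow> m \<noteq> 0 \<Longrightarrow> m \<noteq> 1 \<Longrightarrow> n = 0" for m n :: nat and Q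
      by (simp split: if_splits)
    from this[OF le that] have "count (image_mset fst R) A = 0" .
    then show ?thesis by (simp only: not_in_iff)
  qed
qed

lemma colourings_delete:
  assumes N: "nanophrase N" and mark: "mark \<in> alphabet N \<rightarrow> {1, -1}"
    and "delete_letter mark N N'"
  shows "nanophrase N' \<and> alphabet N' \<subseteq> alphabet N \<and> colourings mark N' = colourings mark N"
proof -
  have pm: "proj N \<in> alphabet N \<rightarrow> {1, -1}" using N by (rule nanophrase_signs)
  from assms(3) show ?thesis
  proof cases
    case (self_eq X A x y Y)
    have AA: "mset (concat (comps N)) = add_mset A (add_mset A (mset (concat (comps N'))))"
      by (simp add: self_eq)
    have "nanophrase N'"
      by (rule nanophrase_remove[OF N _ _ AA]) (simp_all add: self_eq pm flip_once_signs)
    note nr = this nanophrase_letter_twice[OF N AA]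
    have "colourings mark N = colourings mark N'"
    proof (rule colourings_replace)
      show "comps N = X @ [A # x @ [A] @ y] @ Y" "comps N' = X @ [x, y] @ Y" using self_eq by auto
      fix R :: "('a \<times> bool \<times> bool) multiset"
      assume R: "image_mset fst R = mset (concat (X @ Y))"
      show "phrase_sum [A # x @ [A] @ y] (\<lambda>M. of_bool (compatible (\<lambda>A. mark A = proj N A) (R + M))) =
        phrase_sum [x, y] (\<lambda>M. of_bool (compatible (\<lambda>A. mark A = proj N' A) (R + M)))"
      proof (rule smooth_self_eq)
        fix b c d d' and M M' :: "('a \<times> bool \<times> bool) multiset"
        assume M: "image_mset fst M = mset x" "image_mset fst M' = mset y"
        have "A \<notin># image_mset fst (R + (M + M'))"
          using nr(3) R M self_eq(1) by auto
        from compatible_pair[OF this] 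
        show "of_bool (compatible (\<lambda>A. mark A = proj N A)
               (R + add_mset (A, b, c) (add_mset (A, d, d') (M + M')))) =
          (if (d, d') = (c, b) then of_bool (compatible (\<lambda>A. mark A = proj N' A) (R + (M + M'))) else (0::nat))"
          using self_eq by auto
      qed
    qed
    then show ?thesis using nr self_eq by auto
  next
    case (self_neq X A x y Y)
    have AA: "mset (concat (comps N)) = add_mset A (add_mset A (mset (concat (comps N'))))"
      by (simp add: self_neq)
    have "nanophrase N'"
      by (rule nanophrase_remove[OF N _ _ AA]) (simp_all add: self_neq pm flip_once_signs)
    note nr = this nanophrase_letter_twice[OF N AA]
    have "proj N A \<in> {1, -1}" using pm nr(2) by (rule funcset_mem)
    then have e: "mark A \<noteq> proj N A" unfolding \<open>mark A = - proj N A\<close> by auto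
    have pN: "proj N' = flip_once x (proj N)" by (simp add: self_neq)
    have "colourings mark N = colourings mark N'"
    proof (rule colourings_replace)
      show "comps N = X @ [A # x @ [A] @ y] @ Y" "comps N' = X @ [rev x @ y] @ Y" using self_neq by auto
      fix R :: "('a \<times> bool \<times> bool) multiset"
      assume R: "image_mset fst R = mset (concat (X @ Y))"
      show "phrase_sum [A # x @ [A] @ y] (\<lambda>M. of_bool (compatible (\<lambda>A. mark A = proj N A) (R + M))) =
        phrase_sum [rev x @ y] (\<lambda>M. of_bool (compatible (\<lambda>A. mark A = proj N' A) (R + M)))"
      proof (rule smooth_self_neq)
        fix b c d d' and M M' :: "('a \<times> bool \<times> bool) multiset"
        assume M: "image_mset fst M = mset x" "image_mset fst M' = mset y"
        have A: "A \<notin># image_mset fst (R + (M + M'))"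
          using nr(3) R M self_neq(1) by auto
        have "compatible (\<lambda>A. mark A = flip_once x (proj N) A) (image_mset reversed M + (R + M')) =
          compatible (\<lambda>A. mark A = proj N A) (M + (R + M'))"
          by (rule compatible_flip_once[OF N mark M(1)]) (use M R self_neq in \<open>auto simp: subseteq_mset_def\<close>)
        with compatible_pair[OF A]
        show "of_bool (compatible (\<lambda>A. mark A = proj N A)
               (R + add_mset (A, b, c) (add_mset (A, d, d') (M + M')))) =
          (if (d, d') = (b, c) then of_bool (compatible (\<lambda>A. mark A = proj N' A)
             (R + (image_mset reversed M + M'))) else (0::nat))"
          using e by (auto simp: ac_simps pN)
      qed
    qed
    then show ?thesis using nr self_neq by auto
  next
    case (cross_eq X A x y Y)
    have AA: "mset (concat (comps N)) = add_mset A (add_mset A (mset (concat (comps N'))))"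
      by (simp add: cross_eq)
    have "nanophrase N'"
      by (rule nanophrase_remove[OF N _ _ AA]) (simp_all add: cross_eq pm flip_once_signs)
    note nr = this nanophrase_letter_twice[OF N AA]
    have "colourings mark N = colourings mark N'"
    proof (rule colourings_replace)
      show "comps N = X @ [A # x, A # y] @ Y" "comps N' = X @ [x @ y] @ Y" using cross_eq by auto
      fix R :: "('a \<times> bool \<times> bool) multiset"
      assume R: "image_mset fst R = mset (concat (X @ Y))"
      show "phrase_sum [A # x, A # y] (\<lambda>M. of_bool (compatible (\<lambda>A. mark A = proj N A) (R + M))) =
        phrase_sum [x @ y] (\<lambda>M. of_bool (compatible (\<lambda>A. mark A = proj N' A) (R + M)))"
      proof (rule smooth_cross_eq)
        fix b c d d' and M M' :: "('a \<times> bool \<times> bool) multiset"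
        assume M: "image_mset fst M = mset x" "image_mset fst M' = mset y"
        have "A \<notin># image_mset fst (R + (M + M'))"
          using nr(3) R M cross_eq(1) by auto
        from compatible_pair[OF this] 
        show "of_bool (compatible (\<lambda>A. mark A = proj N A)
               (R + add_mset (A, b, c) (add_mset (A, d, d') (M + M')))) =
          (if (d, d') = (c, b) then of_bool (compatible (\<lambda>A. mark A = proj N' A) (R + (M + M'))) else (0::nat))"
          using cross_eq by auto
      qed
    qed
    then show ?thesis using nr cross_eq by auto
  next
    case (cross_neq X A x y Y)
    have AA: "mset (concat (comps N)) = add_mset A (add_mset A (mset (concat (comps N'))))"
      by (simp add: cross_neq)
    have "nanophrase N'"
      by (rule nanophrase_remove[OF N _ _ AA]) (simp_all add: cross_neq pm flip_once_signs)
    note nr = this nanophrase_letter_twice[OF N AA]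
    have "proj N A \<in> {1, -1}" using pm nr(2) by (rule funcset_mem)
    then have e: "mark A \<noteq> proj N A" unfolding \<open>mark A = - proj N A\<close> by auto
    have pN: "proj N' = flip_once x (proj N)" by (simp add: cross_neq)
    have "colourings mark N = colourings mark N'"
    proof (rule colourings_replace)
      show "comps N = X @ [A # x, A # y] @ Y" "comps N' = X @ [rev x @ y] @ Y" using cross_neq by auto
      fix R :: "('a \<times> bool \<times> bool) multiset"
      assume R: "image_mset fst R = mset (concat (X @ Y))"
      show "phrase_sum [A # x, A # y] (\<lambda>M. of_bool (compatible (\<lambda>A. mark A = proj N A) (R + M))) =
        phrase_sum [rev x @ y] (\<lambda>M. of_bool (compatible (\<lambda>A. mark A = proj N' A) (R + M)))"
      proof (rule smooth_cross_neq)
        fix b c d d' and M M' :: "('a \<times> bool \<times> bool) multiset"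
        assume M: "image_mset fst M = mset x" "image_mset fst M' = mset y"
        have A: "A \<notin># image_mset fst (R + (M + M'))"
          using nr(3) R M cross_neq(1) by auto
        have "compatible (\<lambda>A. mark A = flip_once x (proj N) A) (image_mset reversed M + (R + M')) =
          compatible (\<lambda>A. mark A = proj N A) (M + (R + M'))"
          by (rule compatible_flip_once[OF N mark M(1)]) (use M R cross_neq in \<open>auto simp: subseteq_mset_def\<close>)
        with compatible_pair[OF A]
        show "of_bool (compatible (\<lambda>A. mark A = proj N A)
               (R + add_mset (A, b, c) (add_mset (A, d, d') (M + M')))) =
          (if (d, d') = (b, c) then of_bool (compatible (\<lambda>A. mark A = proj N' A)
             (R + (image_mset reversed M + M'))) else (0::nat))"
          using e by (auto simp: ac_simps pN)
      qed
    qed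
    then show ?thesis using nr cross_neq by auto
  qed
qed

lemma colourings_shift:
  assumes "nanophrase N" "nu_shift N N'"
  shows "nanophrase N' \<and> alphabet N' = alphabet N \<and> proj N' = proj N \<and> colourings mark N' = colourings mark N"
  using assms(2)
proof cases
  case (1 X A w Y)
  have "nanophrase N'"
    by (rule nanophrase_rotate[OF assms(1)]) (use 1 nanophrase_signs[OF assms(1)] in auto)
  moreover have "colourings mark N = colourings mark N'"
  proof (rule colourings_replace)
    show "comps N = X @ [A # w] @ Y" "comps N' = X @ [w @ [A]] @ Y" using 1 by simp_all
    have "proj N' = proj N" using 1 by simp
    then show "phrase_sum [A # w] (\<lambda>M. of_bool (compatible (\<lambda>A. mark A = proj N A) (R + M))) =
      phrase_sum [w @ [A]] (\<lambda>M. of_bool (compatible (\<lambda>A. mark A = proj N' A) (R + M)))" for R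
      by (simp only: phrase_sum_shift[of A w])
  qed
  ultimately show ?thesis using 1 by simp
qed

lemma colourings_permutation:
  assumes "nanophrase N" "nu_permutation N N'"
  shows "nanophrase N' \<and> alphabet N' = alphabet N \<and> proj N' = proj N \<and> colourings mark N' = colourings mark N"
  using assms(2)
proof cases
  case (1 X u v Y)
  have "nanophrase N'"
    by (rule nanophrase_rotate[OF assms(1)]) (use 1 nanophrase_signs[OF assms(1)] in auto)
  moreover have "colourings mark N = colourings mark N'"
  proof (rule colourings_replace)
    show "comps N = X @ [u, v] @ Y" "comps N' = X @ [v, u] @ Y" using 1 by simp_all
    have "proj N' = proj N" using 1 by simp
    then show "phrase_sum [u, v] (\<lambda>M. of_bool (compatible (\<lambda>A. mark A = proj N A) (R + M))) =
      phrase_sum [v, u] (\<lambda>M. of_bool (compatible (\<lambda>A. mark A = proj N' A) (R + M)))" for R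
      by (simp only: phrase_sum_swap[of u v])
  qed
  ultimately show ?thesis using 1 by simp
qed

lemma colourings_inversion:
  assumes N: "nanophrase N" and mark: "mark \<in> alphabet N \<rightarrow> {1, -1}" and "nu_inversion N N'"
  shows "nanophrase N' \<and> alphabet N' = alphabet N \<and> colourings mark N' = colourings mark N"
  using assms(3)
proof cases
  case (1 X w Y)
  have "nanophrase N'"
    by (rule nanophrase_rotate[OF N])
      (use 1 flip_once_signs[OF nanophrase_signs[OF N]] in auto)
  moreover have "colourings mark N = colourings mark N'"
  proof (rule colourings_replace[of _ X "[w]" Y _ "[rev w]"])
    fix R :: "('a \<times> bool \<times> bool) multiset"
    assume R: "image_mset fst R = mset (concat (X @ Y))"
    have "phrase_sum [rev w] (\<lambda>M. of_bool (compatible (\<lambda>A. mark A = proj N' A) (R + M))) =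
      phrase_sum [w] (\<lambda>M. of_bool (compatible (\<lambda>A. mark A = proj N' A) (R + image_mset reversed M)))"
      by (rule phrase_sum_inversion)
    also have "\<dots> = phrase_sum [w] (\<lambda>M. of_bool (compatible (\<lambda>A. mark A = proj N A) (R + M)))"
    proof (rule phrase_sum_cong)
      fix M :: "('a \<times> bool \<times> bool) multiset"
      assume M: "image_mset fst M = mset (concat [w])"
      have "compatible (\<lambda>A. mark A = flip_once w (proj N) A) (image_mset reversed M + R) =
        compatible (\<lambda>A. mark A = proj N A) (M + R)"
        by (rule compatible_flip_once[OF N mark]) (use M R 1 in \<open>auto simp: subseteq_mset_def\<close>)
      then show "of_bool (compatible (\<lambda>A. mark A = proj N' A) (R + image_mset reversed M)) =
        (of_bool (compatible (\<lambda>A. mark A = proj N A) (R + M)) :: nat)"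
        using 1 by (simp add: add.commute)
    qed
    finally show "phrase_sum [w] (\<lambda>M. of_bool (compatible (\<lambda>A. mark A = proj N A) (R + M))) =
      phrase_sum [rev w] (\<lambda>M. of_bool (compatible (\<lambda>A. mark A = proj N' A) (R + M)))" ..
  qed (use 1 in auto)
  ultimately show ?thesis using 1 by simp
qed

lemma colourings_smoothing_steps:
  assumes "(smoothing_step mark)\<^sup>*\<^sup>* N E" "nanophrase N" "mark \<in> alphabet N \<rightarrow> {1, -1}"
  shows "nanophrase E \<and> mark \<in> alphabet E \<rightarrow> {1, -1} \<and> colourings mark E = colourings mark N"
  using assms
proof (induction rule: rtranclp_induct)
  case (step M E)
  then have M: "nanophrase M" "mark \<in> alphabet M \<rightarrow> {1, -1}" by auto
  have "nanophrase E \<and> alphabet E \<subseteq> alphabet M \<and> colourings mark E = colourings mark M"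
    using step.hyps(2) M colourings_delete[OF M] colourings_shift[OF M(1)]
      colourings_permutation[OF M(1)] colourings_inversion[OF M]
    unfolding smoothing_step_def by auto
  then show ?case using step M by auto
qed auto

section \<open>The number of circles is well defined\<close>

lemma colourings_empty_words:
  assumes "comps E = replicate n []"
  shows "colourings mark E = 2 ^ n"
proof -
  have "phrase_sum (replicate n []) k = 2 ^ n * k {#}" for k :: "('a \<times> bool \<times> bool) multiset \<Rightarrow> nat"
    by (induction n) (simp_all add: UNIV_bool)
  then show ?thesis by (simp add: colourings_def assms)
qed

lemma smooths_to_colourings:
  assumes "nanophrase N" "mark \<in> alphabet N \<rightarrow> {1, -1}" "smooths_to mark N n"
  shows "colourings mark N = 2 ^ n"
  using assms colourings_smoothing_steps colourings_empty_words unfolding smooths_to_def by metis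

lemma shift_steps:
  assumes "comps N = X @ [u @ v] @ Y"
  shows "(smoothing_step mark)\<^sup>*\<^sup>* N (N\<lparr>comps := X @ [v @ u] @ Y\<rparr>)"
  using assms
proof (induction u arbitrary: N v)
  case Nil
  then have "N\<lparr>comps := X @ [v @ []] @ Y\<rparr> = N" by (cases N) simp
  then show ?case by simp
next
  case (Cons A u)
  let ?N = "N\<lparr>comps := X @ [(u @ v) @ [A]] @ Y\<rparr>"
  have "smoothing_step mark N ?N"
    unfolding smoothing_step_def using nu_shift.intros[of N X A "u @ v" Y] Cons.prems by simp
  also have "(smoothing_step mark)\<^sup>*\<^sup>* ?N (?N\<lparr>comps := X @ [(v @ [A]) @ u] @ Y\<rparr>)"
    by (rule Cons.IH) simp
  finally show ?case by simp
qed

lemma permutation_steps: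
  assumes "comps N = X @ [w] @ V @ Y"
  shows "(smoothing_step mark)\<^sup>*\<^sup>* N (N\<lparr>comps := X @ V @ [w] @ Y\<rparr>)"
  using assms
proof (induction V arbitrary: N X)
  case Nil
  then have "N\<lparr>comps := X @ [] @ [w] @ Y\<rparr> = N" by (cases N) simp
  then show ?case by simp
next
  case (Cons v V)
  let ?N = "N\<lparr>comps := X @ [v, w] @ V @ Y\<rparr>"
  have "smoothing_step mark N ?N"
    unfolding smoothing_step_def using nu_permutation.intros[of N X w v "V @ Y"] Cons.prems by simp
  also have "(smoothing_step mark)\<^sup>*\<^sup>* ?N (?N\<lparr>comps := (X @ [v]) @ V @ [w] @ Y\<rparr>)"
    by (rule Cons.IH) simp
  finally show ?case by simp
qed

text \<open>Shifts bring the letter to the front of its components and permutations make these adjacent, so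
  that one of the deletion rules applies.\<close>

lemma delete_some_letter:
  assumes N: "nanophrase N" and mark: "mark \<in> alphabet N \<rightarrow> {1, -1}" and A: "A \<in> alphabet N"
  shows "\<exists>N'. (smoothing_step mark)\<^sup>*\<^sup>* N N' \<and> alphabet N' = alphabet N - {A}"
proof -
  have step: "smoothing_step mark M M'" if "delete_letter mark M M'" for M M'
    using that by (simp add: smoothing_step_def)
  have "mark A \<in> {1, -1}" "proj N A \<in> {1, -1}"
    using N mark A by (auto simp: nanophrase_def Pi_iff)
  then have sgn: "mark A = proj N A \<or> mark A = - proj N A" by auto
  have 2: "count (mset (concat (comps N))) A = 2" using nanophrase_count[OF N, of A] A by simp
  then have "A \<in> set (concat (comps N))" by (metis count_eq_zero_iff set_mset_mset zero_neq_numeral)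
  then have "\<exists>w\<in>set (comps N). A \<in> set w" by simp
  then obtain X w Y where XY: "comps N = X @ w # Y" "A \<in> set w" "\<forall>v\<in>set X. A \<notin> set v"
    by (elim split_list_first_propE) auto
  from XY(2) obtain u v where w: "w = u @ A # v" by (meson split_list)
  let ?N1 = "N\<lparr>comps := X @ [(A # v) @ u] @ Y\<rparr>"
  have 1: "(smoothing_step mark)\<^sup>*\<^sup>* N ?N1"
    by (rule shift_steps) (simp add: XY w)
  show ?thesis
  proof (cases "A \<in> set (v @ u)")
    case True
    then obtain x y where xy: "v @ u = x @ [A] @ y" by (metis append_Cons append_Nil split_list)
    have c: "comps ?N1 = X @ [A # x @ [A] @ y] @ Y" using xy by simp
    have "\<exists>N'. delete_letter mark ?N1 N' \<and> alphabet N' = alphabet N - {A}"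
      using sgn
    proof
      assume "mark A = proj N A"
      then have "mark A = proj ?N1 A" by simp
      note d = delete_letter.self_eq[where mark = mark, OF c this]
      show ?thesis by (rule exI, rule conjI, rule d, simp)
    next
      assume "mark A = - proj N A"
      then have "mark A = - proj ?N1 A" by simp
      note d = delete_letter.self_neq[where mark = mark, OF c this]
      show ?thesis by (rule exI, rule conjI, rule d, simp)
    qed
    then show ?thesis using 1 step by (meson rtranclp.rtrancl_into_rtrancl)
  next
    case False
    have "A \<in> set (concat Y)"
    proof (rule ccontr)
      assume "A \<notin> set (concat Y)"
      then have Y0: "count (mset (concat Y)) A = 0" by (simp add: count_mset)
      have X0: "count (mset (concat X)) A = 0" using XY(3) by (simp add: count_mset)
      have uv0: "count (mset u) A = 0" "count (mset v) A = 0"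
        using False by (simp_all add: count_mset)
      have "count (mset (concat (comps N))) A =
          count (mset (concat X)) A + (count (mset u) A + Suc (count (mset v) A)) + count (mset (concat Y)) A"
        unfolding XY(1) w by simp
      then have "count (mset (concat (comps N))) A = 1"
        by (simp only: X0 Y0 uv0)
      with 2 show False by simp
    qed
    then have "\<exists>w\<in>set Y. A \<in> set w" by simp
    then obtain w' where "w' \<in> set Y" and Aw': "A \<in> set w'" by blast
    then obtain Y1 Y2 where Y: "Y = Y1 @ w' # Y2" by (meson split_list)
    from Aw' obtain u' v' where w': "w' = u' @ A # v'" by (meson split_list)
    let ?N2 = "?N1\<lparr>comps := X @ Y1 @ [(A # v) @ u] @ [w'] @ Y2\<rparr>"
    let ?N3 = "?N2\<lparr>comps := (X @ Y1 @ [(A # v) @ u]) @ [(A # v') @ u'] @ Y2\<rparr>"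
    have 2: "(smoothing_step mark)\<^sup>*\<^sup>* ?N1 ?N2"
      by (rule permutation_steps) (simp add: Y)
    have 3: "(smoothing_step mark)\<^sup>*\<^sup>* ?N2 ?N3"
      by (rule shift_steps) (simp add: w')
    have c: "comps ?N3 = (X @ Y1) @ [A # (v @ u), A # (v' @ u')] @ Y2" by simp
    have "\<exists>N'. delete_letter mark ?N3 N' \<and> alphabet N' = alphabet N - {A}"
      using sgn
    proof
      assume "mark A = proj N A"
      then have "mark A = proj ?N3 A" by simp
      note d = delete_letter.cross_eq[where mark = mark, OF c this]
      show ?thesis by (rule exI, rule conjI, rule d, simp)
    next
      assume "mark A = - proj N A"
      then have "mark A = - proj ?N3 A" by simp
      note d = delete_letter.cross_neq[where mark = mark, OF c this]
      show ?thesis by (rule exI, rule conjI, rule d, simp)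
    qed
    then show ?thesis using rtranclp_trans[OF rtranclp_trans[OF 1 2] 3]
      step by (meson rtranclp.rtrancl_into_rtrancl)
  qed
qed

lemma smooths_to_exists:
  assumes "nanophrase N" "mark \<in> alphabet N \<rightarrow> {1, -1}"
  shows "\<exists>n. smooths_to mark N n"
  using assms
\<comment> \<open>Every deletion makes the alphabet smaller; with no letters left, only empty words remain.\<close>
proof (induction "card (alphabet N)" arbitrary: N)
  case 0
  then have "alphabet N = {}" by (simp add: nanophrase_def)
  then have "\<forall>w\<in>set (comps N). w = []" using 0 by (auto simp: nanophrase_def)
  then have "comps N = replicate (length (comps N)) []"
    by (metis replicate_length_same)
  then show ?case unfolding smooths_to_def by blast
next
  case (Suc n)
  then obtain A where A: "A \<in> alphabet N" by fastforce
  obtain N' where N': "(smoothing_step mark)\<^sup>*\<^sup>* N N'" "alphabet N' = alphabet N - {A}"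
    using delete_some_letter[OF Suc.prems A] by blast
  have "n = card (alphabet N')" using A N' Suc by (simp add: nanophrase_def)
  with Suc.hyps(1) colourings_smoothing_steps[OF N'(1) Suc.prems]
  obtain m where "smooths_to mark N' m" by blast
  then show ?case using N'(1) unfolding smooths_to_def by (meson rtranclp_trans)
qed

text \<open>Both \<open>2 ^ m\<close> and \<open>2 ^ n\<close> are the number of colourings.\<close>

lemma smooths_to_unique:
  assumes "nanophrase N" "mark \<in> alphabet N \<rightarrow> {1, -1}"
  shows "\<exists>!n. smooths_to mark N n"
proof -
  have "m = n" if "smooths_to mark N m" "smooths_to mark N n" for m n
    using smooths_to_colourings[OF assms that(1)] smooths_to_colourings[OF assms that(2)] by simp
  then show ?thesis using smooths_to_exists[OF assms] by blast
qed

lemma colourings_circles: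
  assumes "nanophrase N" "mark \<in> alphabet N \<rightarrow> {1, -1}"
  shows "colourings mark N = 2 ^ circles N mark"
  using smooths_to_colourings[OF assms] theI'[OF smooths_to_unique[OF assms]]
  unfolding circles_def by blast

lemma circles_shift_by:
  assumes "nanophrase M" "mark \<in> alphabet M \<rightarrow> {1, -1}"
    and "nanophrase N" "mark' \<in> alphabet N \<rightarrow> {1, -1}"
    and "colourings mark M = 2 ^ k * colourings mark' N"
  shows "circles M mark = circles N mark' + k"
proof -
  have "(2::nat) ^ circles M mark = 2 ^ (circles N mark' + k)"
    using assms(5) by (simp add: colourings_circles[OF assms(1,2)] colourings_circles[OF assms(3,4)] power_add)
  then show ?thesis by simp
qed

section \<open>Phrases cut at the spots of a move\<close>

text \<open>The version of \<open>phrase_sum\<close> for words with separators, which are going to be glued. Such a word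
  starts and ends in the middle of a component: \<open>b\<close> is the colour of the arc that closes up the
  current component and \<open>c\<close> the colour of the arc at the start; the continuation gets the
  corresponding two colours at the end. The value on the empty list is a convention, as words with
  separators are nonempty lists.\<close>

primrec open_sum ::
    "'a list list \<Rightarrow> bool \<Rightarrow> bool \<Rightarrow> (bool \<Rightarrow> bool \<Rightarrow> ('a \<times> bool \<times> bool) multiset \<Rightarrow> nat) \<Rightarrow> nat" where
  "open_sum [] b c k = k b c {#}"
| "open_sum (w # ws) b c k =
     (if ws = [] then \<Sum>c'\<in>UNIV. path_sum w c c' (k b c')
      else path_sum w c b (\<lambda>M. \<Sum>b'\<in>UNIV. open_sum ws b' b' (\<lambda>b'' c' M'. k b'' c' (M + M'))))"

lemma open_sum_single: "open_sum [w] b c k = (\<Sum>c'\<in>UNIV. path_sum w c c' (k b c'))"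
  by simp

lemma phrase_sum_open:
  "ws \<noteq> [] \<Longrightarrow> phrase_sum ws k =
     (\<Sum>b\<in>UNIV. open_sum ws b b (\<lambda>b' c M. if b' = c then k M else 0))"
proof (induction ws arbitrary: k rule: list_nonempty_induct)
  case (single w)
  show ?case by (simp add: UNIV_bool)
next
  case (cons w ws)
  then show ?case by simp
qed

lemma open_sum_cong:
  assumes "\<And>b' c' M. image_mset fst M = mset (concat ws) \<Longrightarrow> k b' c' M = k' b' c' M"
  shows "open_sum ws b c k = open_sum ws b c k'"
  using assms
proof (induction ws arbitrary: b c k k')
  case (Cons w ws)
  have "path_sum w c c' (k b c') = path_sum w c c' (k' b c')" if "ws = []" for c'
    by (rule path_sum_cong) (simp add: Cons.prems that)
  moreover have "path_sum w c b (\<lambda>M. \<Sum>b'\<in>UNIV. open_sum ws b' b' (\<lambda>b'' c' M'. k b'' c' (M + M'))) =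
      path_sum w c b (\<lambda>M. \<Sum>b'\<in>UNIV. open_sum ws b' b' (\<lambda>b'' c' M'. k' b'' c' (M + M')))"
    by (intro path_sum_cong sum.cong refl Cons.IH) (auto simp: Cons.prems)
  ultimately show ?case by simp
qed simp

lemma open_sum_sum:
  "open_sum ws b c (\<lambda>b' c' M. \<Sum>i\<in>I. k i b' c' M) = (\<Sum>i\<in>I. open_sum ws b c (k i))"
proof (induction ws arbitrary: b c k)
  case (Cons w ws)
  have "(\<Sum>c'\<in>UNIV. path_sum w c c' (\<lambda>M. \<Sum>i\<in>I. k i b c' M)) = (\<Sum>i\<in>I. \<Sum>c'\<in>UNIV. path_sum w c c' (k i b c'))"
    unfolding path_sum_sum by (rule sum.swap)
  moreover have "(\<Sum>b'\<in>UNIV. \<Sum>i\<in>I. g b' i) = (\<Sum>i\<in>I. \<Sum>b'\<in>UNIV. g b' i)" for g :: "bool \<Rightarrow> _ \<Rightarrow> nat"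
    by (rule sum.swap)
  ultimately show ?case by (simp add: Cons path_sum_sum)
qed simp

lemma open_sum_mult:
  "open_sum ws b c (\<lambda>b' c' M. n * k b' c' M) = n * open_sum ws b c k"
proof (induction ws arbitrary: b c k)
  case (Cons w ws)
  then show ?case by (simp add: path_sum_mult flip: sum_distrib_left)
qed simp

text \<open>This moves a sum over the colourings of a displayed word past the remaining part of the phrase.\<close>

lemma path_open_commute:
  "path_sum u a d (\<lambda>U. open_sum ws b c (\<lambda>b' c' M. k U b' c' M)) =
   open_sum ws b c (\<lambda>b' c' M. path_sum u a d (\<lambda>U. k U b' c' M))"
proof (induction u arbitrary: a k)
  case Nil
  have "open_sum ws b c (\<lambda>b' c' M. 0) = 0" using open_sum_mult[of ws b c 0] by simp
  then show ?case by simp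
next
  case (Cons A u)
  then show ?case by (simp add: open_sum_sum)
qed

lemma glue_Cons: "x \<noteq> [] \<Longrightarrow> (w # x) \<odot> y = w # (x \<odot> y)"
  by (simp add: glue_def)

lemma glue_not_Nil [simp]: "x \<odot> y \<noteq> []"
  by (simp add: glue_def)

lemma glue_unit_left: "y \<noteq> [] \<Longrightarrow> [[]] \<odot> y = y"
  by (simp add: glue_def)

lemma concat_glue: "x \<noteq> [] \<Longrightarrow> y \<noteq> [] \<Longrightarrow> concat (x \<odot> y) = concat x @ concat y"
proof -
  assume x: "x \<noteq> []" and y: "y \<noteq> []"
  have "concat x = concat (butlast x) @ last x"
    using arg_cong[OF append_butlast_last_id[OF x], of concat] by simp
  moreover have "concat y = hd y @ concat (tl y)" using y by (cases y) auto
  ultimately show ?thesis by (simp add: glue_def)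
qed

lemma open_sum_glue:
  assumes "x \<noteq> []" "y \<noteq> []"
  shows "open_sum (x \<odot> y) b c k =
    open_sum x b c (\<lambda>b' c' M. open_sum y b' c' (\<lambda>b'' c'' M'. k b'' c'' (M + M')))"
  using assms(1)
proof (induction x arbitrary: b c k rule: list_nonempty_induct)
  case (single w)
  obtain v ys where y: "y = v # ys" using assms(2) by (cases y) auto
  show ?case
  proof (cases "ys = []")
    case True
    then show ?thesis
      by (simp add: y glue_def path_sum_append path_sum_sum add.assoc) (rule sum.swap)
  next
    case False
    then show ?thesis by (simp add: y glue_def path_sum_append add.assoc)
  qed
next
  case (cons w x)
  then show ?case by (simp add: glue_Cons add.assoc)
qed

text \<open>The part of a phrase outside three displayed spots. The arcs entering the spots have colours \<open>i1\<close>,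
  \<open>i2\<close>, \<open>i3\<close> and the arcs leaving them \<open>o1\<close>, \<open>o2\<close>, \<open>o3\<close>; \<open>F\<close> is the contribution of the spots. The test
  \<open>b4 = c\<close> closes up the last component.\<close>

definition strand_sum :: "'a list list \<Rightarrow> 'a list list \<Rightarrow> 'a list list \<Rightarrow> 'a list list \<Rightarrow>
    (bool \<Rightarrow> bool \<Rightarrow> bool \<Rightarrow> bool \<Rightarrow> bool \<Rightarrow> bool \<Rightarrow> ('a \<times> bool \<times> bool) multiset \<Rightarrow> nat) \<Rightarrow> nat" where
  "strand_sum x y z t F =
     (\<Sum>b\<in>UNIV. open_sum x b b (\<lambda>b1 i1 M1. \<Sum>o1\<in>UNIV. open_sum y b1 o1 (\<lambda>b2 i2 M2.
      \<Sum>o2\<in>UNIV. open_sum z b2 o2 (\<lambda>b3 i3 M3. \<Sum>o3\<in>UNIV. open_sum t b3 o3 (\<lambda>b4 c M4.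
        if b4 = c then F i1 o1 i2 o2 i3 o3 (M1 + M2 + M3 + M4) else 0)))))"

lemma strand_sum_cong:
  assumes "\<And>i1 o1 i2 o2 i3 o3 M. image_mset fst M = mset (concat (x @ y @ z @ t)) \<Longrightarrow>
    F i1 o1 i2 o2 i3 o3 M = F' i1 o1 i2 o2 i3 o3 M"
  shows "strand_sum x y z t F = strand_sum x y z t F'"
  unfolding strand_sum_def
  by (intro sum.cong refl open_sum_cong if_cong assms) simp

lemma strand_sum_mult:
  "strand_sum x y z t (\<lambda>i1 o1 i2 o2 i3 o3 M. n * F i1 o1 i2 o2 i3 o3 M) = n * strand_sum x y z t F"
proof -
  have "(if Q then n * m else 0) = n * (if Q then m else 0)" for Q and m :: nat by simp
  then show ?thesis
    by (simp only: strand_sum_def open_sum_mult sum_distrib_left[symmetric])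
qed

lemma phrase_sum_strands:
  assumes "x \<noteq> []" "y \<noteq> []" "z \<noteq> []" "t \<noteq> []"
  shows "phrase_sum (x \<odot> [u] \<odot> y \<odot> [v] \<odot> z \<odot> [w] \<odot> t) k =
    strand_sum x y z t (\<lambda>i1 o1 i2 o2 i3 o3 M. path_sum u i1 o1 (\<lambda>U. path_sum v i2 o2 (\<lambda>V.
      path_sum w i3 o3 (\<lambda>W. k (U + V + W + M)))))"
  using assms
  by (simp add: phrase_sum_open open_sum_glue strand_sum_def path_open_commute path_sum_sum
      path_sum_if open_sum_single del: open_sum.simps(2))
    (intro sum.cong refl open_sum_cong if_cong path_sum_cong arg_cong[of _ _ k], simp add: ac_simps)

definition local_sum ::
    "('a \<Rightarrow> bool) \<Rightarrow> 'a list \<Rightarrow> 'a list \<Rightarrow> 'a list \<Rightarrow> bool \<Rightarrow> bool \<Rightarrow> bool \<Rightarrow> bool \<Rightarrow> bool \<Rightarrow> bool \<Rightarrow> nat" where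
  "local_sum e u v w i1 o1 i2 o2 i3 o3 =
     path_sum u i1 o1 (\<lambda>U. path_sum v i2 o2 (\<lambda>V. path_sum w i3 o3 (\<lambda>W.
       of_bool (compatible e (U + V + W)))))"


lemma colourings_strands:
  assumes ne: "x \<noteq> []" "y \<noteq> []" "z \<noteq> []" "t \<noteq> []"
    and comps: "comps N = x \<odot> [u] \<odot> y \<odot> [v] \<odot> z \<odot> [w] \<odot> t"
    and disjoint: "set (u @ v @ w) \<inter> set (concat (x @ y @ z @ t)) = {}"
  shows "colourings mark N = strand_sum x y z t (\<lambda>i1 o1 i2 o2 i3 o3 M.
    of_bool (compatible (\<lambda>A. mark A = proj N A) M) *
    local_sum (\<lambda>A. mark A = proj N A) u v w i1 o1 i2 o2 i3 o3)"
  unfolding colourings_def comps phrase_sum_strands[OF ne]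
proof (rule strand_sum_cong)
  let ?e = "\<lambda>A. mark A = proj N A"
  fix i1 o1 i2 o2 i3 o3 and M :: "('a \<times> bool \<times> bool) multiset"
  assume M: "image_mset fst M = mset (concat (x @ y @ z @ t))"
  have "path_sum u i1 o1 (\<lambda>U. path_sum v i2 o2 (\<lambda>V. path_sum w i3 o3
      (\<lambda>W. of_bool (compatible ?e (U + V + W + M))))) =
    path_sum u i1 o1 (\<lambda>U. path_sum v i2 o2 (\<lambda>V. path_sum w i3 o3
      (\<lambda>W. of_bool (compatible ?e M) * of_bool (compatible ?e (U + V + W)))))"
  proof (intro path_sum_cong)
    fix U V W :: "('a \<times> bool \<times> bool) multiset"
    assume UVW: "image_mset fst U = mset u" "image_mset fst V = mset v" "image_mset fst W = mset w"
    have "compatible ?e (U + V + W + M) \<longleftrightarrow> compatible ?e (U + V + W) \<and> compatible ?e M"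
    proof (rule compatible_union)
      fix A assume "A \<in># image_mset fst (U + V + W)"
      then have "A \<in> set (u @ v @ w)" using UVW by auto
      then have "A \<notin> set (concat (x @ y @ z @ t))" using disjoint by blast
      then show "A \<notin># image_mset fst M" unfolding M by simp
    qed
    then show "of_bool (compatible ?e (U + V + W + M)) =
        (of_bool (compatible ?e M) * of_bool (compatible ?e (U + V + W)) :: nat)"
      by (simp only: of_bool_conj mult.commute)
  qed
  also have "\<dots> = of_bool (compatible ?e M) * local_sum ?e u v w i1 o1 i2 o2 i3 o3"
    by (simp only: path_sum_mult local_sum_def)
  finally show "path_sum u i1 o1 (\<lambda>U. path_sum v i2 o2 (\<lambda>V. path_sum w i3 o3
      (\<lambda>W. of_bool (compatible ?e (U + V + W + M))))) =
    of_bool (compatible ?e M) * local_sum ?e u v w i1 o1 i2 o2 i3 o3" .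
qed

text \<open>Two phrases that agree outside the spots have proportional numbers of colourings if their spots
  do, for all colours of the ends. Moves with fewer than three spots are covered by taking some of
  the displayed words empty.\<close>

lemma colourings_tangle_replace:
  assumes ne: "x \<noteq> []" "y \<noteq> []" "z \<noteq> []" "t \<noteq> []"
    and N: "comps N = x \<odot> [u] \<odot> y \<odot> [v] \<odot> z \<odot> [w] \<odot> t"
      "set (u @ v @ w) \<inter> set (concat (x @ y @ z @ t)) = {}"
    and N': "comps N' = x \<odot> [u'] \<odot> y \<odot> [v'] \<odot> z \<odot> [w'] \<odot> t"
      "set (u' @ v' @ w') \<inter> set (concat (x @ y @ z @ t)) = {}"
    and outer: "\<And>A. A \<in> set (concat (x @ y @ z @ t)) \<Longrightarrow>
      (mark A = proj N A) = (mark' A = proj N' A)"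
    and inner: "\<And>i1 o1 i2 o2 i3 o3. local_sum (\<lambda>A. mark A = proj N A) u v w i1 o1 i2 o2 i3 o3 =
      n * local_sum (\<lambda>A. mark' A = proj N' A) u' v' w' i1 o1 i2 o2 i3 o3"
  shows "colourings mark N = n * colourings mark' N'"
  unfolding colourings_strands[OF ne N] colourings_strands[OF ne N'] strand_sum_mult[symmetric]
proof (rule strand_sum_cong)
  fix i1 o1 i2 o2 i3 o3 and M :: "('a \<times> bool \<times> bool) multiset"
  assume M: "image_mset fst M = mset (concat (x @ y @ z @ t))"
  have "compatible (\<lambda>A. mark A = proj N A) M = compatible (\<lambda>A. mark' A = proj N' A) M"
    by (rule compatible_cong) (use outer in \<open>simp only: M set_mset_mset\<close>)
  then show "of_bool (compatible (\<lambda>A. mark A = proj N A) M) *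
      local_sum (\<lambda>A. mark A = proj N A) u v w i1 o1 i2 o2 i3 o3 =
    n * (of_bool (compatible (\<lambda>A. mark' A = proj N' A) M) *
      local_sum (\<lambda>A. mark' A = proj N' A) u' v' w' i1 o1 i2 o2 i3 o3)"
    by (simp only: inner mult.left_commute)
qed

section \<open>Colourings inside the spots\<close>

lemma local_sum_trivial:
  "local_sum e [] [] [] i1 o1 i2 o2 i3 o3 = of_bool (i1 = o1 \<and> i2 = o2 \<and> i3 = o3)"
  by (simp add: local_sum_def)

lemma local_sum_kink:
  "local_sum e [A, A] [] [] i1 o1 i2 o2 i3 o3 =
    (if e A then 2 else 1) * of_bool (i1 = o1 \<and> i2 = o2 \<and> i3 = o3)"
  by (cases i1; cases o1; cases "e A") (simp_all add: local_sum_def UNIV_bool compatible_pair)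

text \<open>Here \<open>m1\<close> and \<open>m2\<close> are the colours of the two sides of the bigon.\<close>

lemma local_sum_bigon:
  assumes "A \<noteq> B"
  shows "local_sum e [A, B] [B, A] [] i1 o1 i2 o2 i3 o3 =
    (\<Sum>m1\<in>UNIV. \<Sum>m2\<in>UNIV. of_bool ((m2, o2) = smoothed (e A) (i1, m1) \<and>
       (i2, m2) = smoothed (e B) (m1, o1) \<and> i3 = o3))"
proof -
  have "compatible e {#(B, q), (A, p), (A, p'), (B, q')#} \<longleftrightarrow>
      p = smoothed (e A) p' \<and> q = smoothed (e B) q'" for p q p' q'
  proof -
    have eq: "{#(B, q), (A, p), (A, p'), (B, q')#} =
        add_mset (A, p') (add_mset (A, p) (add_mset (B, q') (add_mset (B, q) {#})))"
      by (simp add: add_mset_commute)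
    show ?thesis unfolding eq using assms by (simp add: compatible_pair)
  qed
  then show ?thesis
    by (cases i3; cases o3; cases o1; cases o2) (simp_all add: local_sum_def UNIV_bool del: sum_of_bool_eq)
qed


lemma compatible_three:
  assumes "distinct [A, B, C]"
    and "M = {#(A, p), (A, p'), (B, q), (B, q'), (C, r), (C, r')#}"
  shows "compatible e M \<longleftrightarrow>
    p' = smoothed (e A) p \<and> q' = smoothed (e B) q \<and> r' = smoothed (e C) r"
  unfolding assms(2) using assms(1) by (simp add: compatible_pair)

text \<open>Here \<open>m1\<close>, \<open>m2\<close> and \<open>m3\<close> are the colours of the sides of the triangle.\<close>

lemma local_sum_triangle:
  assumes "distinct [A, B, C]"
  shows "local_sum e [A, B] [A, C] [B, C] i1 o1 i2 o2 i3 o3 =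
    (\<Sum>m1\<in>UNIV. \<Sum>m2\<in>UNIV. \<Sum>m3\<in>UNIV. of_bool ((i2, m2) = smoothed (e A) (i1, m1) \<and>
       (i3, m3) = smoothed (e B) (m1, o1) \<and> (m3, o3) = smoothed (e C) (m2, o2)))"
proof -
  have "compatible e {#(B, q'), (C, r'), (A, p'), (C, r), (A, p), (B, q)#} \<longleftrightarrow>
      p' = smoothed (e A) p \<and> q' = smoothed (e B) q \<and> r' = smoothed (e C) r" for p q r p' q' r'
    by (rule compatible_three[OF assms]) (simp add: add_mset_commute)
  then show ?thesis
    by (cases o1; cases o2; cases o3) (simp_all add: local_sum_def UNIV_bool del: sum_of_bool_eq)
qed

lemma local_sum_triangle_moved:
  assumes "distinct [A, B, C]"
  shows "local_sum e [B, A] [C, A] [C, B] i1 o1 i2 o2 i3 o3 =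
    (\<Sum>m1\<in>UNIV. \<Sum>m2\<in>UNIV. \<Sum>m3\<in>UNIV. of_bool ((m2, o2) = smoothed (e A) (m1, o1) \<and>
       (m3, o3) = smoothed (e B) (i1, m1) \<and> (i3, m3) = smoothed (e C) (i2, m2)))"
proof -
  have "compatible e {#(C, r'), (B, q'), (C, r), (A, p'), (B, q), (A, p)#} \<longleftrightarrow>
      p' = smoothed (e A) p \<and> q' = smoothed (e B) q \<and> r' = smoothed (e C) r" for p q r p' q' r'
    by (rule compatible_three[OF assms]) (simp add: add_mset_commute)
  then show ?thesis
    by (cases o1; cases o2; cases o3) (simp_all add: local_sum_def UNIV_bool del: sum_of_bool_eq)
qed

text \<open>In these three states the six ends are joined in the same way on both sides of the move. Two ways of
  joining are told apart by the colourings of the ends that they admit, so comparing all 64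
  colourings decides this.\<close>

lemma triangle_slides:
  assumes "distinct [A, B, C]" and "e' A = e A" "e' B = e B" "e' C = e C"
    and "(e A, e B, e C) \<in> {(False, False, True), (True, False, False), (True, True, True)}"
  shows "local_sum e [A, B] [A, C] [B, C] i1 o1 i2 o2 i3 o3 =
    local_sum e' [B, A] [C, A] [C, B] i1 o1 i2 o2 i3 o3"
  unfolding local_sum_triangle[OF assms(1)] local_sum_triangle_moved[OF assms(1)] assms(2-4)
  using assms(5)
  by (elim insertE; cases i1; cases o1; cases i2; cases o2; cases i3; cases o3)
    (simp_all add: UNIV_bool del: sum_of_bool_eq)

text \<open>All four states of one triangle join the six ends in the same way as the one state of the other
  triangle in which \<open>A\<close> and \<open>C\<close>, but not \<open>B\<close>, are smoothed along the orientation. If only \<open>B\<close> is, the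
  sides of the triangle form an additional circle.\<close>

lemma triangle_collapses:
  assumes "distinct [A, B, C]" and "e' A" "\<not> e' B" "e' C"
    and "(e A, e B, e C) \<in>
      {(False, False, False), (False, True, False), (False, True, True), (True, True, False)}"
  shows "local_sum e [A, B] [A, C] [B, C] i1 o1 i2 o2 i3 o3 =
      (if \<not> e A \<and> e B \<and> \<not> e C then 2 else 1) * local_sum e' [B, A] [C, A] [C, B] i1 o1 i2 o2 i3 o3"
    and "local_sum e [B, A] [C, A] [C, B] i1 o1 i2 o2 i3 o3 =
      (if \<not> e A \<and> e B \<and> \<not> e C then 2 else 1) * local_sum e' [A, B] [A, C] [B, C] i1 o1 i2 o2 i3 o3"
  unfolding local_sum_triangle[OF assms(1)] local_sum_triangle_moved[OF assms(1)]
  using assms(2-5)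
  by (elim insertE; cases i1; cases o1; cases i2; cases o2; cases i3; cases o3;
      simp add: UNIV_bool del: sum_of_bool_eq)+

text \<open>If both letters are smoothed against the orientation, the two strands pass straight through.\<close>

lemma bigon_undoes:
  assumes "A \<noteq> B" "\<not> e A" "\<not> e B"
  shows "local_sum e [A, B] [B, A] [] i1 o1 i2 o2 i3 o3 = local_sum e' [] [] [] i1 o1 i2 o2 i3 o3"
  unfolding local_sum_bigon[OF assms(1)] local_sum_trivial using assms(2,3)
  by (cases i1; cases o1; cases i2; cases o2; simp add: UNIV_bool del: sum_of_bool_eq)

text \<open>In the remaining states each strand turns back; if both letters are smoothed along the orientation,
  the sides of the bigon form an additional circle.\<close>

lemma bigon_turns_back:
  assumes "A \<noteq> B" "e A \<or> e B" "e' A" "\<not> e' B"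
  shows "local_sum e [A, B] [B, A] [] i1 o1 i2 o2 i3 o3 =
    (if e A \<and> e B then 2 else 1) * local_sum e' [A, B] [B, A] [] i1 o1 i2 o2 i3 o3"
  unfolding local_sum_bigon[OF assms(1)] using assms(2,3,4)
  by (cases i1; cases o1; cases i2; cases o2; cases "e A"; cases "e B"; simp add: UNIV_bool del: sum_of_bool_eq)

section \<open>Terms of the state sum\<close>

definition loop_value :: "int poly fract" where
  "loop_value = - (t_var powi 2) - t_var powi (- 2)"

definition state_term :: "'a nanophrase \<Rightarrow> ('a \<Rightarrow> int) \<Rightarrow> int poly fract" where
  "state_term N s = t_var powi sigma N s * loop_value powi (int (circles N s) - 1)"

lemma jones_state_terms:
  "jones N = (- t_var) powi (- 3 * writhe N) * (\<Sum>s\<in>states N. state_term N s)"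
  by (simp add: jones_def state_term_def loop_value_def)

lemma t_var_nonzero [simp]: "t_var \<noteq> 0"
  by (simp add: t_var_def Zero_fract_def eq_fract)

text \<open>Otherwise $t^4 + 1 = 0$, but this polynomial has the value 1 at 0. Division by the loop value occurs
  in the state sum of the phrase without components.\<close>

lemma loop_value_nonzero [simp]: "loop_value \<noteq> 0"
proof
  assume "loop_value = 0"
  then have "t_var powi (- 2) = - (t_var ^ 2)"
    by (simp add: loop_value_def algebra_simps)
  moreover have "t_var ^ 2 * t_var powi (- 2) = 1"
    by (simp add: power_int_minus)
  ultimately have "t_var ^ 2 * - (t_var ^ 2) = 1" by simp
  then have "t_var ^ 4 + 1 = 0"
    by (simp add: minus_equation_iff[of _ 1] flip: power_add)
  moreover have "t_var ^ 4 + 1 = Fract ([:0, 1:] ^ 4 + 1) 1"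
    by (simp add: t_var_def One_fract_def eval_nat_numeral)
  ultimately have "[:0, 1:] ^ 4 + 1 = (0 :: int poly)"
    by (simp add: Zero_fract_def eq_fract)
  then have "poly ([:0, 1:] ^ 4 + 1) (0::int) = 0" by simp
  then show False by simp
qed

text \<open>Ordering the two signs as \<open>p\<close>, \<open>- p\<close> allows \<open>p\<close> to be the projection of \<open>A\<close>, so that the first
  summand always belongs to the smoothing along the orientation.\<close>

lemma sum_states_insert:
  fixes p :: int
  assumes "A \<notin> S" "p \<in> {1, -1}"
  shows "(\<Sum>s\<in>insert A S \<rightarrow>\<^sub>E {1, -1}. F s) =
    (\<Sum>r\<in>S \<rightarrow>\<^sub>E {1, -1}. F (r(A := p)) + F (r(A := - p)))"
proof -
  have "(\<Sum>s\<in>insert A S \<rightarrow>\<^sub>E {1, -1}. F s) =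
      (\<Sum>(v, r)\<in>{1, -1} \<times> (S \<rightarrow>\<^sub>E {1, -1}). F (r(A := v)))"
    unfolding PiE_insert_eq
    by (subst sum.reindex[OF inj_combinator[OF assms(1)]]) (simp add: case_prod_unfold)
  also have "\<dots> = (\<Sum>v\<in>{1, -1}. \<Sum>r\<in>S \<rightarrow>\<^sub>E {1, -1}. F (r(A := v)))"
    by (simp add: sum.cartesian_product)
  also have "{1, -1} = {p, - p}" using assms(2) by auto
  also have "(\<Sum>v\<in>{p, - p}. \<Sum>r\<in>S \<rightarrow>\<^sub>E {p, - p}. F (r(A := v))) =
      (\<Sum>r\<in>S \<rightarrow>\<^sub>E {p, - p}. F (r(A := p)) + F (r(A := - p)))"
    using assms(2) by (auto simp: sum.distrib)
  finally show ?thesis using assms(2) by (auto simp: insert_commute)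
qed

lemma Pi_update: "r \<in> S \<rightarrow> T \<Longrightarrow> v \<in> T \<Longrightarrow> r(A := v) \<in> insert A S \<rightarrow> T"
  by auto

lemma sum_update:
  fixes r :: "'a \<Rightarrow> int"
  assumes "finite S" "A \<notin> S"
  shows "(\<Sum>D\<in>insert A S. (r(A := v)) D) = v + (\<Sum>D\<in>S. r D)"
proof -
  have "(\<Sum>D\<in>S. (r(A := v)) D) = (\<Sum>D\<in>S. r D)"
    by (rule sum.cong) (use assms in auto)
  then show ?thesis using assms by simp
qed

lemma sigma_sum:
  assumes "finite (alphabet N)" "s \<in> alphabet N \<rightarrow> {1, -1}"
  shows "sigma N s = (\<Sum>A\<in>alphabet N. s A)"
proof -
  have "(\<Sum>A\<in>alphabet N. s A) = (\<Sum>A\<in>alphabet N. of_bool (s A = 1) - of_bool (s A = -1))"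
    by (rule sum.cong) (use assms(2) in auto)
  also have "\<dots> = sigma N s"
    using assms(1) by (simp add: sum_subtractf sigma_def Int_def)
  finally show ?thesis ..
qed


section \<open>Invariance under the homotopy moves\<close>

text \<open>The expression in brackets is the effect of a kink with sign \<open>p\<close> on the sum over all states: its
  smoothing along the orientation splits off a circle. The power of \<open>- t_var\<close> comes from the writhe.\<close>

lemma kink_factor:
  assumes "p \<in> {1, -1}"
  shows "(- t_var) powi (- 3 * p) * (t_var powi p * loop_value + t_var powi (- p)) = 1"
proof -
  have "p = 1 \<or> p = -1" using assms by auto
  then show ?thesis
  proof
    assume "p = 1"
    then show ?thesis
      by (simp add: loop_value_def power_int_minus field_simps power_numeral_reduce)
  next
    assume "p = -1"
    then show ?thesis
      by (simp add: loop_value_def power_int_minus field_simps power_numeral_reduce)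
  qed
qed

lemma bigon_factor:
  assumes "p \<in> {1, -1}"
  shows "t_var powi (2 * p) + loop_value + t_var powi (- 2 * p) = 0"
  using assms by (auto simp: loop_value_def)

text \<open>The weights of \<open>triangle_collapses\<close>. For the two triples of signs outside \<open>S1\<close> the equation fails.\<close>

lemma triangle_factor:
  assumes "(p, q, r) \<in> S1"
  shows "t_var powi (p - q + r) = t_var powi (- p - q - r) + loop_value * t_var powi (- p + q - r) +
    t_var powi (- p + q + r) + t_var powi (p + q - r)"
  using assms unfolding S1_def
  by (elim insertE; simp add: loop_value_def power_int_minus field_simps power_numeral_reduce)

lemma loop_value_Suc: "loop_value powi (int (n + 1) - 1) = loop_value * loop_value powi (int n - 1)"
  by (simp add: power_int_diff)

lemma jones_H1:
  assumes M: "nanophrase M" and N: "nanophrase N" and ne: "x \<noteq> []" "y \<noteq> []"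
    and cM: "comps M = x \<odot> [[A, A]] \<odot> y" and cN: "comps N = x \<odot> y"
    and aN: "alphabet N = alphabet M - {A}"
    and pN: "\<forall>D\<in>alphabet N. proj N D = proj M D"
  shows "jones N = jones M"
proof -
  let ?S = "alphabet N" and ?p = "proj M A"
  \<comment> \<open>The kink occupies one spot; the other two hold the empty word.\<close>
  have cM': "comps M = x \<odot> [[A, A]] \<odot> [[]] \<odot> [[]] \<odot> [[]] \<odot> [[]] \<odot> y"
    and cN': "comps N = x \<odot> [[]] \<odot> [[]] \<odot> [[]] \<odot> [[]] \<odot> [[]] \<odot> y"
    using ne by (simp_all add: cM cN glue_unit_left)
  have AR: "mset (concat (comps M)) = add_mset A (add_mset A (mset (concat (comps N))))"
    using ne by (simp add: cM cN concat_glue)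
  note A = nanophrase_letter_twice[OF M AR]
  have aM: "alphabet M = insert A ?S" and AS: "A \<notin> ?S" using A aN by auto
  have p: "?p \<in> {1, -1}" using nanophrase_signs[OF M] A(1) by (rule funcset_mem)
  have fin: "finite ?S" "finite (alphabet M)" using M N by (auto simp: nanophrase_def)
  have lets: "D \<in> ?S" if "D \<in> set (concat (x @ [[]] @ [[]] @ y))" for D
    using that N ne by (auto simp: nanophrase_def cN concat_glue)
  have circ: "circles M (r(A := v)) = circles N r + (if v = ?p then 1 else 0)"
    if r': "r \<in> ?S \<rightarrow> {1, -1}" and v: "v \<in> {1, -1}" for r v
  proof (rule circles_shift_by[OF M _ N])
    show "r(A := v) \<in> alphabet M \<rightarrow> {1, -1}" "r \<in> ?S \<rightarrow> {1, -1}"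
      using Pi_update[OF r' v] r' by (simp_all only: aM)
    show "colourings (r(A := v)) M = 2 ^ (if v = ?p then 1 else 0) * colourings r N"
    proof (rule colourings_tangle_replace[OF ne(1) _ _ ne(2) cM' _ cN'])
      show "set ([A, A] @ [] @ []) \<inter> set (concat (x @ [[]] @ [[]] @ y)) = {}"
        using lets AS by auto
      show "((r(A := v)) D = proj M D) = (r D = proj N D)"
        if "D \<in> set (concat (x @ [[]] @ [[]] @ y))" for D
        using lets[OF that] AS pN by auto
      show "local_sum (\<lambda>D. (r(A := v)) D = proj M D) [A, A] [] [] i1 o1 i2 o2 i3 o3 =
        2 ^ (if v = ?p then 1 else 0) * local_sum (\<lambda>D. r D = proj N D) [] [] [] i1 o1 i2 o2 i3 o3"
        for i1 o1 i2 o2 i3 o3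
        by (simp add: local_sum_kink local_sum_trivial)
    qed simp_all
  qed
  have sig: "sigma M (r(A := v)) = v + sigma N r"
    if r': "r \<in> ?S \<rightarrow> {1, -1}" and v: "v \<in> {1, -1}" for r v
  proof -
    have m: "r(A := v) \<in> alphabet M \<rightarrow> {1, -1}" using Pi_update[OF r' v] by (simp only: aM)
    show ?thesis
      unfolding sigma_sum[OF fin(2) m] sigma_sum[OF fin(1) r']
      by (simp only: aM sum_update[OF fin(1) AS])
  qed
  have "(\<Sum>s\<in>states M. state_term M s) =
      (\<Sum>r\<in>states N. state_term M (r(A := ?p)) + state_term M (r(A := - ?p)))"
    unfolding states_def aM by (rule sum_states_insert[OF AS p])
  also have "\<dots> = (\<Sum>r\<in>states N. (t_var powi ?p * loop_value + t_var powi (- ?p)) * state_term N r)"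
  proof (rule sum.cong[OF refl])
    fix r assume "r \<in> states N"
    then have r: "r \<in> ?S \<rightarrow> {1, -1}" by (simp add: states_def PiE_def)
    have "- ?p \<noteq> ?p" "- ?p \<in> {1, -1}" using p by auto
    then show "state_term M (r(A := ?p)) + state_term M (r(A := - ?p)) =
        (t_var powi ?p * loop_value + t_var powi (- ?p)) * state_term N r"
      unfolding state_term_def sig[OF r p] circ[OF r p]
        sig[OF r \<open>- ?p \<in> {1, -1}\<close>] circ[OF r \<open>- ?p \<in> {1, -1}\<close>] power_int_add[OF disjI1[OF t_var_nonzero]]
      by (simp only: simp_thms if_True if_False loop_value_Suc add_0_right) (simp only: algebra_simps)
  qed
  also have "\<dots> = (t_var powi ?p * loop_value + t_var powi (- ?p)) * (\<Sum>r\<in>states N. state_term N r)"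
    by (simp add: sum_distrib_left)
  finally have sums: "(\<Sum>s\<in>states M. state_term M s) =
    (t_var powi ?p * loop_value + t_var powi (- ?p)) * (\<Sum>r\<in>states N. state_term N r)" .
  have "writhe M = writhe N + ?p"
    using fin AS pN by (simp add: writhe_def aM)
  then have "(- t_var) powi (- 3 * writhe M) = (- t_var) powi (- 3 * writhe N) * (- t_var) powi (- 3 * ?p)"
    by (simp add: algebra_simps flip: power_int_add)
  then have "jones M = (- t_var) powi (- 3 * writhe N) * (\<Sum>r\<in>states N. state_term N r) *
      ((- t_var) powi (- 3 * ?p) * (t_var powi ?p * loop_value + t_var powi (- ?p)))"
    unfolding jones_state_terms sums by (simp only: ac_simps)
  then show ?thesis unfolding kink_factor[OF p] by (simp add: jones_state_terms)
qed


text \<open>Besides the state that undoes the bigon there are three states; their terms have a common factor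
  and cancel by \<open>bigon_factor\<close>.\<close>

lemma jones_H2:
  assumes M: "nanophrase M" and N: "nanophrase N" and ne: "x \<noteq> []" "y \<noteq> []" "z \<noteq> []"
    and pB: "proj M B = - proj M A"
    and cM: "comps M = x \<odot> [[A, B]] \<odot> y \<odot> [[B, A]] \<odot> z" and cN: "comps N = x \<odot> y \<odot> z"
    and aN: "alphabet N = alphabet M - {A, B}"
    and pN: "\<forall>D\<in>alphabet N. proj N D = proj M D"
  shows "jones N = jones M"
proof -
  let ?S = "alphabet N" and ?p = "proj M A"
  let ?q = "- ?p"
  \<comment> \<open>The third spot holds the empty word.\<close>
  have cM': "comps M = x \<odot> [[A, B]] \<odot> y \<odot> [[B, A]] \<odot> [[]] \<odot> [[]] \<odot> z"
    and cN': "comps N = x \<odot> [[]] \<odot> y \<odot> [[]] \<odot> [[]] \<odot> [[]] \<odot> z"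
    using ne by (simp_all add: cM cN glue_unit_left)
  have "mset (concat (comps M)) =
      add_mset A (add_mset A (add_mset B (add_mset B (mset (concat (comps N))))))"
    and "mset (concat (comps M)) =
      add_mset B (add_mset B (add_mset A (add_mset A (mset (concat (comps N))))))"
    using ne by (simp_all add: cM cN concat_glue)
  note A = nanophrase_letter_twice[OF M this(1)] and B = nanophrase_letter_twice[OF M this(2)]
  have AB: "A \<noteq> B" using A by auto
  have aM: "alphabet M = insert A (insert B ?S)" and BS: "B \<notin> ?S" and AS: "A \<notin> insert B ?S"
    using A B aN AB by auto
  have p: "?p \<in> {1, -1}" using nanophrase_signs[OF M] A(1) by (rule funcset_mem)
  then have q: "?q \<in> {1, -1}" and pq: "?p \<noteq> ?q" "?q \<noteq> ?p" by auto
  have fin: "finite ?S" "finite (insert B ?S)" "finite (alphabet M)" using M N by (auto simp: nanophrase_def)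
  have lets: "D \<in> ?S" if "D \<in> set (concat (x @ y @ [[]] @ z))" for D
    using that N ne by (auto simp: nanophrase_def cN concat_glue)
  have outside: "set ([A, B] @ [B, A] @ []) \<inter> set (concat (x @ y @ [[]] @ z)) = {}"
    using lets AS BS by auto
  have marks: "r(B := b, A := a) \<in> alphabet M \<rightarrow> {1, -1}"
    if "r \<in> ?S \<rightarrow> {1, -1}" "a \<in> {1, -1}" "b \<in> {1, -1}" for r a b
    unfolding aM by (intro Pi_update that)
  have sig: "sigma M (r(B := b, A := a)) = a + (b + sigma N r)"
    if "r \<in> ?S \<rightarrow> {1, -1}" "a \<in> {1, -1}" "b \<in> {1, -1}" for r a b
    unfolding sigma_sum[OF fin(3) marks[OF that]] sigma_sum[OF fin(1) that(1)]
    by (simp only: aM sum_update[OF fin(2) AS] sum_update[OF fin(1) BS])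
  have undo: "circles M (r(B := ?p, A := ?q)) = circles N r"
    if r: "r \<in> ?S \<rightarrow> {1, -1}" for r
  proof (rule circles_shift_by[OF M marks[OF r q p] N r, where k = 0, unfolded add_0_right])
    show "colourings (r(B := ?p, A := ?q)) M = 2 ^ 0 * colourings r N"
    proof (rule colourings_tangle_replace[OF ne(1,2) _ ne(3) cM' outside cN'])
      show "((r(B := ?p, A := ?q)) D = proj M D) = (r D = proj N D)"
        if "D \<in> set (concat (x @ y @ [[]] @ z))" for D
        using lets[OF that] AS BS pN by auto
      show "local_sum (\<lambda>D. (r(B := ?p, A := ?q)) D = proj M D) [A, B] [B, A] [] i1 o1 i2 o2 i3 o3 =
        2 ^ 0 * local_sum (\<lambda>D. r D = proj N D) [] [] [] i1 o1 i2 o2 i3 o3" for i1 o1 i2 o2 i3 o3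
        unfolding power_0 mult_1_left by (rule bigon_undoes) (use AB pB pq in auto)
    qed simp_all
  qed
  \<comment> \<open>The state with \<open>A\<close> smoothed along and \<open>B\<close> against the orientation serves as reference.\<close>
  have turn: "circles M (r(B := b, A := a)) = circles M (r(B := ?p, A := ?p)) + (if a = ?p \<and> b = ?q then 1 else 0)"
    if r: "r \<in> ?S \<rightarrow> {1, -1}" and ab: "a \<in> {1, -1}" "b \<in> {1, -1}" "a = ?p \<or> b = ?q" for r a b
  proof (rule circles_shift_by[OF M marks[OF r ab(1,2)] M marks[OF r p p]])
    show "colourings (r(B := b, A := a)) M =
      2 ^ (if a = ?p \<and> b = ?q then 1 else 0) * colourings (r(B := ?p, A := ?p)) M"
    proof (rule colourings_tangle_replace[OF ne(1,2) _ ne(3) cM' outside cM' outside])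
      show "((r(B := b, A := a)) D = proj M D) = ((r(B := ?p, A := ?p)) D = proj M D)"
        if "D \<in> set (concat (x @ y @ [[]] @ z))" for D
        using lets[OF that] AS BS by auto
      have two: "(2::nat) ^ (if a = ?p \<and> b = ?q then 1 else 0) =
          (if (r(B := b, A := a)) A = proj M A \<and> (r(B := b, A := a)) B = proj M B then 2 else 1)"
        using AB pB by simp
      show "local_sum (\<lambda>D. (r(B := b, A := a)) D = proj M D) [A, B] [B, A] [] i1 o1 i2 o2 i3 o3 =
        2 ^ (if a = ?p \<and> b = ?q then 1 else 0) *
        local_sum (\<lambda>D. (r(B := ?p, A := ?p)) D = proj M D) [A, B] [B, A] [] i1 o1 i2 o2 i3 o3"
        for i1 o1 i2 o2 i3 o3
        unfolding two by (rule bigon_turns_back) (use AB pB pq ab in auto)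
    qed simp_all
  qed
  have "(\<Sum>s\<in>states M. state_term M s) =
      (\<Sum>r\<in>states N. state_term M (r(B := ?p, A := ?p)) + state_term M (r(B := ?p, A := ?q)) +
        (state_term M (r(B := ?q, A := ?p)) + state_term M (r(B := ?q, A := ?q))))"
    unfolding states_def aM
    by (simp only: sum_states_insert[OF AS p] sum_states_insert[OF BS p])
  also have "\<dots> = (\<Sum>r\<in>states N. state_term N r)"
  proof (rule sum.cong[OF refl])
    fix r assume "r \<in> states N"
    then have r: "r \<in> ?S \<rightarrow> {1, -1}" by (simp add: states_def PiE_def)
    define u where "u = t_var powi sigma N r"
    define n where "n = circles M (r(B := ?p, A := ?p))"
    define d where "d = loop_value powi (int n - 1)"
    have add: "t_var powi (a + b) = t_var powi a * t_var powi b" for a b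
      by (rule power_int_add) simp
    have twice: "?p + (?p + sigma N r) = 2 * ?p + sigma N r" "?q + (?q + sigma N r) = - 2 * ?p + sigma N r"
      by simp_all
    have pp: "state_term M (r(B := ?p, A := ?p)) = t_var powi (2 * ?p) * u * d"
      unfolding state_term_def sig[OF r p p] d_def n_def u_def twice by (simp only: add)
    have qq: "state_term M (r(B := ?q, A := ?q)) = t_var powi (- 2 * ?p) * u * d"
      unfolding state_term_def sig[OF r q q] d_def n_def u_def turn[OF r q q disjI2[OF refl]] twice
      by (simp only: add pq simp_thms if_False add_0_right)
    have "state_term M (r(B := ?q, A := ?p)) = loop_value * u * d"
      unfolding state_term_def sig[OF r p q] d_def n_def u_def turn[OF r p q disjI1[OF refl]]
      by (simp only: loop_value_Suc if_True simp_thms) simp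
    moreover have "state_term M (r(B := ?p, A := ?q)) = state_term N r"
      unfolding state_term_def sig[OF r q p] undo[OF r] by simp
    ultimately have "state_term M (r(B := ?p, A := ?p)) + state_term M (r(B := ?p, A := ?q)) +
        (state_term M (r(B := ?q, A := ?p)) + state_term M (r(B := ?q, A := ?q))) =
      (t_var powi (2 * ?p) + loop_value + t_var powi (- 2 * ?p)) * u * d + state_term N r"
      unfolding pp qq by (simp only: algebra_simps)
    then show "state_term M (r(B := ?p, A := ?p)) + state_term M (r(B := ?p, A := ?q)) +
        (state_term M (r(B := ?q, A := ?p)) + state_term M (r(B := ?q, A := ?q))) = state_term N r"
      unfolding bigon_factor[OF p] by simp
  qed
  finally have sums: "(\<Sum>s\<in>states M. state_term M s) = (\<Sum>r\<in>states N. state_term N r)" .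
  have "(\<Sum>D\<in>?S. proj M D) = (\<Sum>D\<in>?S. proj N D)" by (rule sum.cong) (use pN in auto)
  then have "writhe M = writhe N"
    using fin AS BS pB by (simp add: writhe_def aM)
  then show ?thesis by (simp add: jones_state_terms sums)
qed


text \<open>For fixed markers of the other letters, write \<open>(a, b, c)\<close> for the markers of \<open>A\<close>, \<open>B\<close>, \<open>C\<close>. The states
  \<open>(- p, - q, w)\<close>, \<open>(p, - q, - w)\<close> and \<open>(p, q, w)\<close> have equal terms before and after the move. The state
  \<open>(p, - q, w)\<close> of one side has as many circles as the four collapsing states of the other side
  (one of them has one more), and \<open>triangle_factor\<close> says that its weight is the sum of theirs. So both
  sides have the same summands once these four terms are collected.\<close>

lemma jones_H3:
  assumes M: "nanophrase M" and N: "nanophrase N" and ne: "x \<noteq> []" "y \<noteq> []" "z \<noteq> []" "t \<noteq> []"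
    and S1: "(proj M A, proj M B, proj M C) \<in> S1"
    and cM: "comps M = x \<odot> [[A, B]] \<odot> y \<odot> [[A, C]] \<odot> z \<odot> [[B, C]] \<odot> t"
    and cN: "comps N = x \<odot> [[B, A]] \<odot> y \<odot> [[C, A]] \<odot> z \<odot> [[C, B]] \<odot> t"
    and aN: "alphabet N = alphabet M"
    and pN: "\<forall>D\<in>alphabet N. proj N D = proj M D"
  shows "jones N = jones M"
proof -
  let ?S = "alphabet M - {A, B, C}"
  define p where "p = proj M A"
  define q where "q = proj M B"
  define w where "w = proj M C"
  let ?R = "mset (concat x) + mset (concat y) + mset (concat z) + mset (concat t)"
  have "mset (concat (comps M)) = add_mset A (add_mset A (add_mset B (add_mset B (add_mset C (add_mset C ?R)))))"
    and "mset (concat (comps M)) = add_mset B (add_mset B (add_mset A (add_mset A (add_mset C (add_mset C ?R)))))"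
    and "mset (concat (comps M)) = add_mset C (add_mset C (add_mset A (add_mset A (add_mset B (add_mset B ?R)))))"
    using ne by (simp_all add: cM concat_glue)
  note A = nanophrase_letter_twice[OF M this(1)] and B = nanophrase_letter_twice[OF M this(2)]
    and C = nanophrase_letter_twice[OF M this(3)]
  have dist: "distinct [A, B, C]" using A B by auto
  have aM: "alphabet M = insert A (insert B (insert C ?S))" and CS: "C \<notin> ?S"
    and BS: "B \<notin> insert C ?S" and AS: "A \<notin> insert B (insert C ?S)"
    using A B C dist by auto
  have fin: "finite ?S" "finite (insert C ?S)" "finite (insert B (insert C ?S))"
    "finite (alphabet M)" "finite (alphabet N)"
    using M N by (auto simp: nanophrase_def)
  have pqw: "p \<in> {1, -1}" "q \<in> {1, -1}" "w \<in> {1, -1}"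
    unfolding p_def q_def w_def
    by (rule funcset_mem[OF nanophrase_signs[OF M]], rule A B C)+
  have neg: "- p \<in> {1, -1}" "- q \<in> {1, -1}" "- w \<in> {1, -1}"
    "- p \<noteq> p" "- q \<noteq> q" "- w \<noteq> w"
    using pqw by auto
  have lets: "D \<in> ?S" if "D \<in> set (concat (x @ y @ z @ t))" for D
  proof -
    have "D \<in> alphabet M" using that M ne by (auto simp: nanophrase_def cM concat_glue)
    moreover have "D \<in># ?R" using that by auto
    ultimately show ?thesis using A B C by auto
  qed
  have outside: "set ([A, B] @ [A, C] @ [B, C]) \<inter> set (concat (x @ y @ z @ t)) = {}"
    "set ([B, A] @ [C, A] @ [C, B]) \<inter> set (concat (x @ y @ z @ t)) = {}"
  proof -
    have "{A, B, C} \<inter> set (concat (x @ y @ z @ t)) = {}" using lets by blast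
    moreover have "set ([A, B] @ [A, C] @ [B, C]) = {A, B, C}" "set ([B, A] @ [C, A] @ [C, B]) = {A, B, C}"
      by auto
    ultimately show "set ([A, B] @ [A, C] @ [B, C]) \<inter> set (concat (x @ y @ z @ t)) = {}"
      "set ([B, A] @ [C, A] @ [C, B]) \<inter> set (concat (x @ y @ z @ t)) = {}"
      by (simp_all only:)
  qed
  define s where "s r a b c = r(C := c, B := b, A := a)" for r :: "'a \<Rightarrow> int" and a b c
  have s_simps: "s r a b c A = a" "s r a b c B = b" "s r a b c C = c"
    "D \<in> ?S \<Longrightarrow> s r a b c D = r D" for r a b c D
    using dist by (auto simp: s_def)
  have marksM: "s r a b c \<in> alphabet M \<rightarrow> {1, -1}"
    if "r \<in> ?S \<rightarrow> {1, -1}" "a \<in> {1, -1}" "b \<in> {1, -1}" "c \<in> {1, -1}" for r a b c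
    unfolding s_def by (subst aM) (intro Pi_update that)
  then have marksN: "s r a b c \<in> alphabet N \<rightarrow> {1, -1}"
    if "r \<in> ?S \<rightarrow> {1, -1}" "a \<in> {1, -1}" "b \<in> {1, -1}" "c \<in> {1, -1}" for r a b c
    using that by (simp only: aN)
  have sum_s: "(\<Sum>D\<in>alphabet M. s r a b c D) = a + (b + (c + (\<Sum>D\<in>?S. r D)))" for r a b c
    unfolding s_def
    by (subst aM) (simp only: sum_update[OF fin(3) AS] sum_update[OF fin(2) BS] sum_update[OF fin(1) CS])
  have sigM: "sigma M (s r a b c) = a + b + c + (\<Sum>D\<in>?S. r D)"
    and sigN: "sigma N (s r a b c) = a + b + c + (\<Sum>D\<in>?S. r D)"
    if "r \<in> ?S \<rightarrow> {1, -1}" "a \<in> {1, -1}" "b \<in> {1, -1}" "c \<in> {1, -1}" for r a b c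
    unfolding sigma_sum[OF fin(4) marksM[OF that]] sigma_sum[OF fin(5) marksN[OF that]] aN sum_s
    by simp_all
  have outerM: "(s r a b c D = proj M D) = (s r a' b' c' D = proj N D)"
    and outerN: "(s r a b c D = proj N D) = (s r a' b' c' D = proj M D)"
    if "D \<in> set (concat (x @ y @ z @ t))" for r a b c a' b' c' D
    using lets[OF that] pN aN by (auto simp: s_simps)
  have proj: "proj M A = p" "proj M B = q" "proj M C = w" "proj N A = p" "proj N B = q" "proj N C = w"
    using A B C pN aN by (auto simp: p_def q_def w_def)
  have slide: "circles M (s r a b c) = circles N (s r a b c)"
    if r: "r \<in> ?S \<rightarrow> {1, -1}" and abc: "a \<in> {1, -1}" "b \<in> {1, -1}" "c \<in> {1, -1}"
      and mem: "(a = p, b = q, c = w) \<in> {(False, False, True), (True, False, False), (True, True, True)}"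
    for r a b c
  proof (rule circles_shift_by[OF M marksM[OF r abc] N marksN[OF r abc], where k = 0, unfolded add_0_right])
    show "colourings (s r a b c) M = 2 ^ 0 * colourings (s r a b c) N"
    proof (rule colourings_tangle_replace[OF ne cM outside(1) cN outside(2) outerM])
      show "local_sum (\<lambda>D. s r a b c D = proj M D) [A, B] [A, C] [B, C] i1 o1 i2 o2 i3 o3 =
        2 ^ 0 * local_sum (\<lambda>D. s r a b c D = proj N D) [B, A] [C, A] [C, B] i1 o1 i2 o2 i3 o3"
        for i1 o1 i2 o2 i3 o3
        unfolding power_0 mult_1_left
        by (rule triangle_slides[OF dist]) (use mem in \<open>simp_all only: s_simps proj\<close>)
    qed
  qed
  have collapse: "circles M (s r a b c) = circles N (s r p (- q) w) + (if a \<noteq> p \<and> b = q \<and> c \<noteq> w then 1 else 0)"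
    "circles N (s r a b c) = circles M (s r p (- q) w) + (if a \<noteq> p \<and> b = q \<and> c \<noteq> w then 1 else 0)"
    if r: "r \<in> ?S \<rightarrow> {1, -1}" and abc: "a \<in> {1, -1}" "b \<in> {1, -1}" "c \<in> {1, -1}"
      and mem: "(a = p, b = q, c = w) \<in>
        {(False, False, False), (False, True, False), (False, True, True), (True, True, False)}"
    for r a b c
  proof -
    have pow: "(2::nat) ^ (if a \<noteq> p \<and> b = q \<and> c \<noteq> w then 1 else 0) =
        (if \<not> s r a b c A = proj M A \<and> s r a b c B = proj M B \<and> \<not> s r a b c C = proj M C then 2 else 1)"
      "(2::nat) ^ (if a \<noteq> p \<and> b = q \<and> c \<noteq> w then 1 else 0) =
        (if \<not> s r a b c A = proj N A \<and> s r a b c B = proj N B \<and> \<not> s r a b c C = proj N C then 2 else 1)"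
      by (simp_all add: s_simps proj)
    show "circles M (s r a b c) = circles N (s r p (- q) w) + (if a \<noteq> p \<and> b = q \<and> c \<noteq> w then 1 else 0)"
    proof (rule circles_shift_by[OF M marksM[OF r abc] N marksN[OF r pqw(1) neg(2) pqw(3)]])
      show "colourings (s r a b c) M = 2 ^ (if a \<noteq> p \<and> b = q \<and> c \<noteq> w then 1 else 0) *
        colourings (s r p (- q) w) N"
      proof (rule colourings_tangle_replace[OF ne cM outside(1) cN outside(2) outerM])
        show "local_sum (\<lambda>D. s r a b c D = proj M D) [A, B] [A, C] [B, C] i1 o1 i2 o2 i3 o3 =
          2 ^ (if a \<noteq> p \<and> b = q \<and> c \<noteq> w then 1 else 0) *
          local_sum (\<lambda>D. s r p (- q) w D = proj N D) [B, A] [C, A] [C, B] i1 o1 i2 o2 i3 o3"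
          for i1 o1 i2 o2 i3 o3
          unfolding pow(1)
          by (rule triangle_collapses(1)[OF dist]) (use mem neg in \<open>simp_all only: s_simps proj not_False_eq_True\<close>)
      qed
    qed
    show "circles N (s r a b c) = circles M (s r p (- q) w) + (if a \<noteq> p \<and> b = q \<and> c \<noteq> w then 1 else 0)"
    proof (rule circles_shift_by[OF N marksN[OF r abc] M marksM[OF r pqw(1) neg(2) pqw(3)]])
      show "colourings (s r a b c) N = 2 ^ (if a \<noteq> p \<and> b = q \<and> c \<noteq> w then 1 else 0) *
        colourings (s r p (- q) w) M"
      proof (rule colourings_tangle_replace[OF ne cN outside(2) cM outside(1) outerN])
        show "local_sum (\<lambda>D. s r a b c D = proj N D) [B, A] [C, A] [C, B] i1 o1 i2 o2 i3 o3 =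
          2 ^ (if a \<noteq> p \<and> b = q \<and> c \<noteq> w then 1 else 0) *
          local_sum (\<lambda>D. s r p (- q) w D = proj M D) [A, B] [A, C] [B, C] i1 o1 i2 o2 i3 o3"
          for i1 o1 i2 o2 i3 o3
          unfolding pow(2)
          by (rule triangle_collapses(2)[OF dist]) (use mem neg in \<open>simp_all only: s_simps proj not_False_eq_True\<close>)
      qed
    qed
  qed
  define W where "W a b c = t_var powi (a + b + c)" for a b c :: int
  have skein: "W p (- q) w = W (- p) (- q) (- w) + loop_value * W (- p) q (- w) + W (- p) q w + W p q (- w)"
    using triangle_factor[of p q w] S1 by (simp add: W_def p_def q_def w_def)
  have expand: "(\<Sum>m\<in>states K. state_term K m) = (\<Sum>r\<in>?S \<rightarrow>\<^sub>E {1, -1}.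
      state_term K (s r p q w) + state_term K (s r (- p) q w) +
      (state_term K (s r p (- q) w) + state_term K (s r (- p) (- q) w)) +
      (state_term K (s r p q (- w)) + state_term K (s r (- p) q (- w)) +
      (state_term K (s r p (- q) (- w)) + state_term K (s r (- p) (- q) (- w)))))"
    if K: "alphabet K = alphabet M" for K
    unfolding states_def K s_def
    by (subst aM) (simp only: sum_states_insert[OF AS pqw(1)] sum_states_insert[OF BS pqw(2)]
        sum_states_insert[OF CS pqw(3)])
  have sums: "(\<Sum>m\<in>states N. state_term N m) = (\<Sum>m\<in>states M. state_term M m)"
    unfolding expand[OF refl] expand[OF aN]
  proof (rule sum.cong[OF refl])
    fix r :: "'a \<Rightarrow> int" assume "r \<in> ?S \<rightarrow>\<^sub>E {1, -1}"
    then have r: "r \<in> ?S \<rightarrow> {1, -1}" by (simp add: PiE_def)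
    define u where "u = t_var powi (\<Sum>D\<in>?S. r D)"
    define d where "d n = loop_value powi (int n - 1)" for n
    have dSuc: "d (n + 1) = loop_value * d n" for n
      unfolding d_def by (rule loop_value_Suc)
    have terms: "state_term M (s r a b c) = W a b c * u * d (circles M (s r a b c))"
      "state_term N (s r a b c) = W a b c * u * d (circles N (s r a b c))"
      if "a \<in> {1, -1}" "b \<in> {1, -1}" "c \<in> {1, -1}" for a b c
      unfolding state_term_def sigM[OF r that] sigN[OF r that] W_def u_def d_def
      by (simp_all add: power_int_add)
    note sg = pqw neg(1-3)
    have ne': "(- p = p) = False" "(- q = q) = False" "(- w = w) = False"
      using neg(4-6) by simp_all
    have slides: "circles M (s r (- p) (- q) w) = circles N (s r (- p) (- q) w)"
      "circles M (s r p (- q) (- w)) = circles N (s r p (- q) (- w))"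
      "circles M (s r p q w) = circles N (s r p q w)"
      by (rule slide[OF r neg(1,2) pqw(3)] slide[OF r pqw(1) neg(2,3)] slide[OF r pqw],
          simp only: ne' simp_thms insert_iff)+
    have collapses:
      "circles M (s r (- p) (- q) (- w)) = circles N (s r p (- q) w)"
      "circles M (s r (- p) q (- w)) = circles N (s r p (- q) w) + 1"
      "circles M (s r (- p) q w) = circles N (s r p (- q) w)"
      "circles M (s r p q (- w)) = circles N (s r p (- q) w)"
      "circles N (s r (- p) (- q) (- w)) = circles M (s r p (- q) w)"
      "circles N (s r (- p) q (- w)) = circles M (s r p (- q) w) + 1"
      "circles N (s r (- p) q w) = circles M (s r p (- q) w)"
      "circles N (s r p q (- w)) = circles M (s r p (- q) w)"
      by (subst collapse[OF r neg(1-3)] collapse[OF r neg(1) pqw(2) neg(3)]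
            collapse[OF r neg(1) pqw(2,3)] collapse[OF r pqw(1,2) neg(3)],
          simp only: ne' simp_thms insert_iff,
          simp only: ne' simp_thms if_True if_False add_0_right)+
    show "state_term N (s r p q w) + state_term N (s r (- p) q w) +
        (state_term N (s r p (- q) w) + state_term N (s r (- p) (- q) w)) +
        (state_term N (s r p q (- w)) + state_term N (s r (- p) q (- w)) +
        (state_term N (s r p (- q) (- w)) + state_term N (s r (- p) (- q) (- w)))) =
      state_term M (s r p q w) + state_term M (s r (- p) q w) +
        (state_term M (s r p (- q) w) + state_term M (s r (- p) (- q) w)) +
        (state_term M (s r p q (- w)) + state_term M (s r (- p) q (- w)) +
        (state_term M (s r p (- q) (- w)) + state_term M (s r (- p) (- q) (- w))))"
      by (simp only: terms sg slides collapses dSuc) (simp only: skein algebra_simps)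
  qed
  have "(\<Sum>D\<in>alphabet N. proj N D) = (\<Sum>D\<in>alphabet M. proj M D)"
    by (rule sum.cong) (use pN aN in auto)
  then have "writhe N = writhe M" by (simp only: writhe_def)
  then show ?thesis by (simp add: jones_state_terms sums)
qed

section \<open>Invariance under isomorphisms, shifts and permutations\<close>

lemma path_sum_map:
  "path_sum (map f w) a b k = path_sum w a b (\<lambda>M. k (image_mset (map_prod f id) M))"
  by (induction w arbitrary: a k) simp_all

lemma phrase_sum_map:
  "phrase_sum (map (map f) ws) k = phrase_sum ws (\<lambda>M. k (image_mset (map_prod f id) M))"
  by (induction ws arbitrary: k) (simp_all add: path_sum_map)

lemma occ_map:
  assumes "inj_on f (insert A (fst ` set_mset M))"
  shows "occ (f A) (image_mset (map_prod f id) M) = occ A M"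
  using assms
proof (induction M)
  case (add x M)
  obtain B p where x: "x = (B, p)" by (cases x)
  have "f B = f A \<longleftrightarrow> B = A" using add.prems x by (auto simp: inj_on_def)
  moreover have "inj_on f (insert A (fst ` set_mset M))"
    using add.prems by (rule inj_on_subset) auto
  ultimately show ?case using add.IH x by simp
qed simp

lemma compatible_ball:
  "compatible e M \<longleftrightarrow> (\<forall>A\<in>fst ` set_mset M. letter_ok (e A) (occ A M))"
proof -
  have "letter_ok (e A) (occ A M)" if "A \<notin> fst ` set_mset M" for A
    using that occ_eq_empty[of A M] by simp
  then show ?thesis unfolding compatible_def by blast
qed

lemma compatible_map:
  assumes "inj_on f (fst ` set_mset M)"
  shows "compatible e (image_mset (map_prod f id) M) = compatible (e \<circ> f) M"
proof -
  let ?K = "image_mset (map_prod f id) M"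
  have letters: "fst ` set_mset ?K = f ` fst ` set_mset M"
    by force
  have occs: "occ (f A) ?K = occ A M" if "A \<in> fst ` set_mset M" for A
    by (rule occ_map) (use that assms in \<open>simp add: insert_absorb\<close>)
  have "compatible e ?K \<longleftrightarrow> (\<forall>A\<in>fst ` set_mset M. letter_ok (e (f A)) (occ (f A) ?K))"
    unfolding compatible_ball[of e] letters by blast
  also have "\<dots> \<longleftrightarrow> compatible (e \<circ> f) M"
    unfolding compatible_ball[of "e \<circ> f"] comp_apply using occs by auto
  finally show ?thesis .
qed

text \<open>Pulling back states along the isomorphism is a bijection that preserves every term.\<close>

lemma jones_isomorphic:
  assumes M: "nanophrase M" and N: "nanophrase N" and iso: "isomorphic M N"
  shows "jones N = jones M"
proof -
  obtain f where f: "bij_betw f (alphabet M) (alphabet N)"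
    and pf: "\<forall>A\<in>alphabet M. proj N (f A) = proj M A" and cf: "comps N = map (map f) (comps M)"
    using iso unfolding isomorphic_def by blast
  define g where "g = inv_into (alphabet M) f"
  have fg: "f (g D) = D" "g D \<in> alphabet M" if "D \<in> alphabet N" for D
    using f that unfolding g_def by (auto simp: bij_betw_def f_inv_into_f inv_into_into)
  have gf: "g (f A) = A" "f A \<in> alphabet N" if "A \<in> alphabet M" for A
    using f that unfolding g_def by (auto simp: bij_betw_def)
  have fin: "finite (alphabet M)" "finite (alphabet N)" using M N by (auto simp: nanophrase_def)
  let ?pull = "\<lambda>s. restrict (s \<circ> f) (alphabet M)"
  have pull: "?pull s \<in> states M" if "s \<in> states N" for s
    using that gf(2) by (auto simp: states_def PiE_iff)
  have same: "state_term N s = state_term M (?pull s)" if "s \<in> states N" for s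
  proof -
    have sN: "s \<in> alphabet N \<rightarrow> {1, -1}" using that by (auto simp: states_def PiE_iff)
    have sM: "?pull s \<in> alphabet M \<rightarrow> {1, -1}" using pull[OF that] by (auto simp: states_def PiE_iff)
    have "sigma N s = (\<Sum>A\<in>alphabet M. s (f A))"
      unfolding sigma_sum[OF fin(2) sN] by (rule sum.reindex_bij_betw[OF f, symmetric])
    then have sig: "sigma N s = sigma M (?pull s)"
      unfolding sigma_sum[OF fin(1) sM] by simp
    have "colourings s N = colourings (?pull s) M"
      unfolding colourings_def cf phrase_sum_map
    proof (rule phrase_sum_cong)
      fix K :: "('a \<times> bool \<times> bool) multiset"
      assume K: "image_mset fst K = mset (concat (comps M))"
      have sub: "fst ` set_mset K \<subseteq> alphabet M"
        using M arg_cong[OF K, of set_mset] by (simp add: nanophrase_def)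
      then have "inj_on f (fst ` set_mset K)"
        using f by (auto simp: bij_betw_def intro: inj_on_subset)
      from compatible_map[OF this]
      have "compatible (\<lambda>D. s D = proj N D) (image_mset (map_prod f id) K) =
          compatible (\<lambda>A. s (f A) = proj N (f A)) K"
        by (simp add: comp_def)
      also have "\<dots> = compatible (\<lambda>A. ?pull s A = proj M A) K"
        by (rule compatible_cong) (use sub pf in auto)
      finally show "of_bool (compatible (\<lambda>D. s D = proj N D) (image_mset (map_prod f id) K)) =
          (of_bool (compatible (\<lambda>A. ?pull s A = proj M A) K) :: nat)"
        by simp
    qed
    then have "circles N s = circles M (?pull s)"
      using circles_shift_by[OF N sN M sM, of 0] by simp
    with sig show ?thesis by (simp add: state_term_def)
  qed
  have "(\<Sum>s\<in>states N. state_term N s) = (\<Sum>r\<in>states M. state_term M r)"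
  proof (rule sum.reindex_bij_witness[where i = "\<lambda>r. restrict (r \<circ> g) (alphabet N)" and j = ?pull])
    show "restrict (?pull s \<circ> g) (alphabet N) = s" if "s \<in> states N" for s
      using that fg by (auto simp: states_def PiE_iff extensional_def fun_eq_iff)
    show "?pull (restrict (r \<circ> g) (alphabet N)) = r" if "r \<in> states M" for r
      using that gf by (auto simp: states_def PiE_iff extensional_def fun_eq_iff)
    show "restrict (r \<circ> g) (alphabet N) \<in> states N" if "r \<in> states M" for r
      using that fg(2) by (auto simp: states_def PiE_iff)
  qed (use pull same in auto)
  moreover have "writhe N = writhe M"
  proof -
    have "writhe N = (\<Sum>A\<in>alphabet M. proj N (f A))"
      unfolding writhe_def by (rule sum.reindex_bij_betw[OF f, symmetric])
    then show ?thesis unfolding writhe_def using pf by simp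
  qed
  ultimately show ?thesis by (simp add: jones_state_terms)
qed

lemma jones_s1_move:
  assumes "s1_move M N"
  shows "jones N = jones M"
  using assms
proof cases
  case iso
  then show ?thesis by (rule jones_isomorphic)
next
  case H1
  then show ?thesis by (rule jones_H1)
next
  case (H2 x y z B A)
  show ?thesis by (rule jones_H2[OF H2(1-5) H2(6)[unfolded tau1_def] H2(7-10)])
next
  case H3
  then show ?thesis by (rule jones_H3)
qed

lemma jones_s1_homotopic:
  assumes "s1_homotopic P Q"
  shows "jones Q = jones P"
  using assms unfolding s1_homotopic_def
proof (induction rule: equivclp_induct)
  case (step Q R)
  from step.hyps(2) have "jones R = jones Q"
  proof
    assume "s1_move Q R"
    then show ?thesis by (rule jones_s1_move)
  next
    assume "s1_move R Q"
    then show ?thesis by (rule jones_s1_move[symmetric])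
  qed
  with step.IH show ?case by simp
qed simp

lemma jones_same_diagram:
  assumes "nanophrase P" "nanophrase Q" "alphabet Q = alphabet P" "proj Q = proj P"
    and "\<And>mark. colourings mark Q = colourings mark P"
  shows "jones Q = jones P"
proof -
  have "state_term Q s = state_term P s" if "s \<in> states P" for s
  proof -
    have "s \<in> alphabet P \<rightarrow> {1, -1}" using that by (simp add: states_def PiE_def)
    with assms have "circles Q s = circles P s"
      using circles_shift_by[of Q s P s 0] by simp
    then show ?thesis by (simp add: state_term_def sigma_def assms(3))
  qed
  then show ?thesis using assms(3,4) by (simp add: jones_state_terms states_def writhe_def)
qed

theorem theorem2:
  fixes L :: "'a nanophrase set" and P :: "'a nanophrase"
  assumes "L \<in> pseudolinks" and "P \<in> L"
  shows "(\<forall>s\<in>states P. \<exists>!n. smooths_to s P n) \<and>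
    (\<forall>Q. s1_homotopic P Q \<longrightarrow> jones Q = jones P) \<and>
    (\<forall>Q. nu_shift P Q \<or> nu_permutation P Q \<longrightarrow> jones Q = jones P)"
proof (intro conjI allI impI ballI)
  have P: "nanophrase P"
    using assms by (auto simp: pseudolinks_def quotient_def)
  show "\<exists>!n. smooths_to s P n" if "s \<in> states P" for s
    using smooths_to_unique[OF P] that by (simp add: states_def PiE_def)
  show "jones Q = jones P" if "s1_homotopic P Q" for Q
    using that by (rule jones_s1_homotopic)
  show "jones Q = jones P" if "nu_shift P Q \<or> nu_permutation P Q" for Q
    using that
  proof
    assume "nu_shift P Q"
    from colourings_shift[OF P this] show ?thesis by (intro jones_same_diagram P) auto
  next
    assume "nu_permutation P Q"
    from colourings_permutation[OF P this] show ?thesis by (intro jones_same_diagram P) auto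
  qed
qed

end
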